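(* Let $a\in(-1,0)\cup(0,1)$ and let $C_a$ be the Chebyshev's method of $p_a(z)=(z^2-1)(z^2-a)$. The Julia set of $C_a$ is connected if and only if the Julia component containing a non-zero pole of $C_a$ is unbounded.
   Context: For a polynomial $p$, the Chebyshev's method of $p$ is the rational map $C_p(z)=z-\left[1+\frac12 L_p(z)\right]\frac{p(z)}{p'(z)}$ with $L_p(z)=\frac{p(z)p''(z)}{(p'(z))^2}$, regarded as a self-map of the Riemann sphere $\widehat{\mathbb C}$. For $p_a(z)=(z^2-1)(z^2-a)$ write $C_a:=C_{p_a}$. The Julia set $\mathcal J(C_a)\subset\widehat{\mathbb C}$ is the complement of the set of points having a neighbourhood on which $\{C_a^n\}_{n>0}$ is normal. A Julia component is a connected component of $\mathcal J(C_a)$. The poles of $C_a$ (points of $\mathbb C$ mapped to $\infty$) are $0$ and $\pm\sqrt{(a+1)/2}$, and they lie in the Julia set, as does $\infty$ (a repelling fixed point); the non-zero poles are $\pm\sqrt{(a+1)/2}$. Since $C_a$ is odd, the Julia component containing one non-zero pole is bounded if and only if the one containing the other is. *)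

theory Defs
  imports
    "HOL-Analysis.Analysis"
    "HOL-Computational_Algebra.Computational_Algebra"
    "HOL-Computational_Algebra.Field_as_Ring"
begin

text \<open>
  The Riemann sphere is the one-point compactification of the complex plane;
  the point at infinity is \<^term>\<open>None\<close>.
\<close>

type_synonym sphere = "complex option"

definition riemann_sphere :: "sphere topology"
  where "riemann_sphere = Alexandroff_compactification euclidean"

fun chordal_dist :: "sphere \<Rightarrow> sphere \<Rightarrow> real" where
  "chordal_dist (Some z) (Some w) =
     2 * norm (z - w) / (sqrt (1 + (norm z)\<^sup>2) * sqrt (1 + (norm w)\<^sup>2))"
| "chordal_dist (Some z) None = 2 / sqrt (1 + (norm z)\<^sup>2)"
| "chordal_dist None (Some w) = 2 / sqrt (1 + (norm w)\<^sup>2)"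
| "chordal_dist None None = 0"

text \<open>
  The self-map of the sphere induced by a rational function. The pair
  \<^term>\<open>quot_of_fract R\<close> is coprime with nonzero second entry, so a zero of the
  denominator is a pole. At infinity the value is the limit of \<open>P z / Q z\<close>; the
  coefficient \<^term>\<open>coeff P (degree Q)\<close> vanishes if \<^prop>\<open>degree P < degree Q\<close>.
\<close>

definition rat_map :: "complex poly fract \<Rightarrow> sphere \<Rightarrow> sphere" where
  "rat_map R x =
     (let (P, Q) = quot_of_fract R in
      case x of
        Some z \<Rightarrow> if poly Q z = 0 then None else Some (poly P z / poly Q z)
      | None \<Rightarrow> if degree P > degree Q then None
                else Some (coeff P (degree Q) / lead_coeff Q))"

definition chebyshev_L :: "complex poly \<Rightarrow> complex poly fract" where
  "chebyshev_L p = to_fract p * to_fract (pderiv (pderiv p)) / (to_fract (pderiv p))\<^sup>2"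

definition chebyshev_method :: "complex poly \<Rightarrow> complex poly fract" where
  "chebyshev_method p =
     to_fract [:0, 1:] - (1 + 1/2 * chebyshev_L p) * (to_fract p / to_fract (pderiv p))"

definition p_poly :: "real \<Rightarrow> complex poly" where
  "p_poly a = [:-1, 0, 1:] * [:- of_real a, 0, 1:]"

definition C_map :: "real \<Rightarrow> sphere \<Rightarrow> sphere" where
  "C_map a = rat_map (chebyshev_method (p_poly a))"

text \<open>
  The limit \<open>g\<close> is an arbitrary map into the sphere; in particular it may take the
  value infinity, or be constantly infinity.
\<close>

definition normal_family_on :: "sphere set \<Rightarrow> (sphere \<Rightarrow> sphere) set \<Rightarrow> bool" where
  "normal_family_on U F \<longleftrightarrow>
     (\<forall>f :: nat \<Rightarrow> sphere \<Rightarrow> sphere. range f \<subseteq> F \<longrightarrow>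
        (\<exists>r g. strict_mono r \<and>
           (\<forall>K. compactin riemann_sphere K \<and> K \<subseteq> U \<longrightarrow>
              (\<forall>\<epsilon>>0. \<forall>\<^sub>F n in sequentially. \<forall>x\<in>K. chordal_dist (f (r n) x) (g x) < \<epsilon>))))"

definition fatou_set :: "(sphere \<Rightarrow> sphere) \<Rightarrow> sphere set" where
  "fatou_set f =
     {x. \<exists>U. openin riemann_sphere U \<and> x \<in> U \<and> normal_family_on U {f ^^ n |n. n > 0}}"

definition julia_set :: "(sphere \<Rightarrow> sphere) \<Rightarrow> sphere set" where
  "julia_set f = - fatou_set f"

definition julia_component :: "(sphere \<Rightarrow> sphere) \<Rightarrow> sphere \<Rightarrow> sphere set" where
  "julia_component f x = connected_component_of_set (subtopology riemann_sphere (julia_set f)) x"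

text \<open>A subset of the sphere is bounded if it is a bounded subset of the plane.\<close>

definition sphere_bounded :: "sphere set \<Rightarrow> bool" where
  "sphere_bounded A \<longleftrightarrow> (\<exists>B. bounded B \<and> A = Some ` B)"

definition finite_pole :: "(sphere \<Rightarrow> sphere) \<Rightarrow> complex \<Rightarrow> bool" where
  "finite_pole f z \<longleftrightarrow> f (Some z) = None"

end

theory Submission
  imports Defs "HOL-Complex_Analysis.Complex_Analysis"
begin

text \<open>
  If the Julia set \<open>J\<close> is connected, the component of the pole \<open>q\<close> is \<open>J\<close>, which contains infinity.
  Conversely, suppose the component of \<open>q\<close>, and by oddness that of \<open>-q\<close>, contains infinity, and let \<open>K\<close>
  be a relatively clopen part of \<open>J\<close> without infinity. Then \<open>K\<close> avoids \<open>q\<close> and \<open>-q\<close>. It also avoids the pole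
  \<open>0\<close>, by the dynamics on the imaginary axis.

  For \<open>a > 0\<close> the map expands the metric \<open>\<bar>dy\<bar> / \<bar>y\<bar>\<close> on the imaginary axis, so the whole axis lies in \<open>J\<close>.
  For \<open>a < 0\<close>, every Fatou point of the axis lies in the basin of one of the roots \<open>\<plusminus>\<surd>a\<close>, because
  \<open>\<bar>C'\<bar> \<ge> 2\<close> wherever \<open>L \<le> -2\<close>; a clopen part containing \<open>0\<close> would be surrounded by a connected subset of the
  Fatou set, symmetric under \<open>z \<mapsto> -z\<close> and crossing the axis, whose points would lie in both basins.

  As \<open>K\<close> contains no pole, \<open>C\<close> is open near \<open>K\<close> and \<open>C(K)\<close> is again a clopen part without infinity.
  So all iterates omit \<open>0\<close>, \<open>q\<close> and infinity near \<open>K\<close>, and \<open>K\<close> is empty by Montel's theorem.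
\<close>

section \<open>The Riemann sphere\<close>

text \<open>The obstacle is the pole \<open>0\<close>: the hypothesis says nothing about it, and it
  is the only pole fixed by the symmetry z to -z, so it needs an argument of its own. On the
  imaginary axis z = iy, the map with s = 1 + a becomes the real Chebyshev map with s replaced by
  -s, that is, the one of (y^2 + 1)(y^2 + a), whose only real pole is 0. For a > 0 this quartic has
  no real zero to be attracted to; for a < 0 it has two, exchanged by the symmetry. Hence the two
  cases. Clopen parts are used rather than components, since a component of J need not be relatively
  clopen, while a disconnected J always has a nonempty clopen part without infinity. Near such a
  part every other point is a Fatou point, whose orbit avoids the poles because these lie in J; so
  Montel's theorem applies on a whole disc. Normality is exploited in two ways: a Fatou point that
  is a limit of points of a basin belongs to the basin, and derivatives of iterates cannot blow up
  along a bounded subsequence of a Fatou orbit.\<close>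

lemma topspace_riemann_sphere [simp]: "topspace riemann_sphere = UNIV"
  by (simp add: riemann_sphere_def UNIV_option_conv)

lemma compact_space_riemann_sphere: "compact_space riemann_sphere"
  by (simp add: riemann_sphere_def)

lemma Hausdorff_space_riemann_sphere: "Hausdorff_space riemann_sphere"
  unfolding riemann_sphere_def Hausdorff_space_Alexandroff_compactification
  by (simp add: Hausdorff_space_euclidean locally_compact_space_euclidean)

lemma openin_riemann_sphere_iff:
  "openin riemann_sphere U \<longleftrightarrow>
     open (Some -` U) \<and> (None \<in> U \<longrightarrow> (\<exists>R. \<forall>z. norm z > R \<longrightarrow> Some z \<in> U))" (is "?L = ?R")
proof
  assume ?L
  then consider V where "open V" "U = Some ` V"
    | C where "compact C" "U = insert None (Some ` (- C))"
    by (auto simp: riemann_sphere_def openin_Alexandroff_compactification Compl_eq_Diff_UNIV)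
  then show ?R
  proof cases
    case 1
    then show ?thesis by (auto simp: inj_vimage_image_eq)
  next
    case 2
    have "Some -` U = - C" using 2 by auto
    moreover obtain R where "\<forall>x\<in>C. norm x \<le> R"
      using 2 compact_imp_bounded bounded_iff by blast
    ultimately show ?thesis using 2
      by (auto simp: compact_imp_closed intro!: exI[of _ R]) (metis ComplI image_eqI linorder_not_le)
  qed
next
  assume R: ?R
  show ?L
  proof (cases "None \<in> U")
    case False
    then have "U = Some ` (Some -` U)" using False by (auto simp: image_iff) (metis option.exhaust)
    then show ?thesis using R
      unfolding riemann_sphere_def by (metis open_openin openin_Alexandroff_compactification_image_Some)
  next
    case True
    then obtain r where r: "\<forall>z. norm z > r \<longrightarrow> Some z \<in> U" using R by blast
    define C where "C = - (Some -` U)"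
    have "closed C" using R by (simp add: C_def closed_def)
    moreover have "bounded C" using r by (auto simp: C_def bounded_iff intro!: exI[of _ r])
    ultimately have "compact C" by (simp add: compact_eq_bounded_closed)
    moreover have "U = insert None (Some ` (UNIV - C))"
      using True by (auto simp: C_def image_iff)
    ultimately show ?thesis
      unfolding riemann_sphere_def openin_Alexandroff_compactification
      by (metis compact_imp_closed compactin_euclidean_iff closed_closedin topspace_euclidean)
  qed
qed

section \<open>Stereographic projection and the chordal metric\<close>

fun stereo :: "sphere \<Rightarrow> complex \<times> real" where
  "stereo (Some z) = ((2 / (1 + (norm z)\<^sup>2)) *\<^sub>R z, 1 - 2 / (1 + (norm z)\<^sup>2))"
| "stereo None = (0, 1)"

lemma one_plus_norm_sq_pos: "1 + (norm z)\<^sup>2 > 0" for z :: complex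
  by (simp add: add_pos_nonneg)

text \<open>Writing A = 1 + |z|^2 and B = 1 + |w|^2 reduces the identity to algebra in A, B and the
  inner product. It makes the chordal distance a Euclidean one, which supplies all the metric
  laws.\<close>

lemma dist_stereo: "dist (stereo x) (stereo y) = chordal_dist x y"
proof -
  have fin: "(dist (stereo (Some z)) None')\<^sup>2 = (chordal_dist (Some z) None)\<^sup>2"
    if "None' = stereo None" for z None'
  proof -
    define A where "A = 1 + (norm z)\<^sup>2"
    have A: "A > 0" "(norm z)\<^sup>2 = A - 1" unfolding A_def using one_plus_norm_sq_pos by auto
    have "(dist (stereo (Some z)) None')\<^sup>2 = (2/A)\<^sup>2 * (norm z)\<^sup>2 + (2/A)\<^sup>2"
      using A(1) by (simp add: that norm_Pair dist_norm power_mult_distrib power_divide flip: A_def)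
    also have "\<dots> = 4 / A" using A(1) unfolding A(2) by (simp add: field_simps power2_eq_square)
    also have "\<dots> = (chordal_dist (Some z) None)\<^sup>2"
      using A(1) by (simp add: power_divide flip: A_def)
    finally show ?thesis .
  qed
  have both: "(dist (stereo (Some z)) (stereo (Some w)))\<^sup>2 = (chordal_dist (Some z) (Some w))\<^sup>2" for z w
  proof -
    define A B where "A = 1 + (norm z)\<^sup>2" and "B = 1 + (norm w)\<^sup>2"
    have A: "A > 0" "(norm z)\<^sup>2 = A - 1" unfolding A_def using one_plus_norm_sq_pos by auto
    have B: "B > 0" "(norm w)\<^sup>2 = B - 1" unfolding B_def using one_plus_norm_sq_pos by auto
    define m where "m = z \<bullet> w"
    have nz: "z \<bullet> z = A - 1" "w \<bullet> w = B - 1" using A B by (simp_all add: power2_norm_eq_inner)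
    have 1: "(norm (z - w))\<^sup>2 = A + B - 2 - 2 * m"
      unfolding power2_norm_eq_inner by (simp add: inner_diff inner_commute m_def nz)
    have 2: "(norm ((2/A) *\<^sub>R z - (2/B) *\<^sub>R w))\<^sup>2 = (2/A)\<^sup>2 * (A-1) + (2/B)\<^sup>2*(B-1) - 2 * (2/A)*(2/B)*m"
      unfolding power2_norm_eq_inner
      by (simp add: inner_diff inner_commute m_def nz power2_eq_square)
    have "(dist (stereo (Some z)) (stereo (Some w)))\<^sup>2 =
        (2/A)\<^sup>2 * (A-1) + (2/B)\<^sup>2*(B-1) - 2 * (2/A)*(2/B)*m + (2/B - 2/A)\<^sup>2"
      unfolding 2[symmetric] by (simp add: norm_Pair dist_norm flip: A_def B_def)
    also have "\<dots> = 4 * (A + B - 2 - 2 * m) / (A * B)"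
      using A(1) B(1) by (simp add: field_simps power2_eq_square)
    also have "\<dots> = (chordal_dist (Some z) (Some w))\<^sup>2"
      using A(1) B(1) by (simp add: power_divide power_mult_distrib 1 flip: A_def B_def)
    finally show ?thesis .
  qed
  have "chordal_dist x y \<ge> 0" by (cases x; cases y) auto
  moreover have "(dist (stereo x) (stereo y))\<^sup>2 = (chordal_dist x y)\<^sup>2"
    using fin[OF refl] both by (cases x; cases y) (auto simp: dist_commute)
  ultimately show ?thesis by simp
qed

lemma chordal_dist_commute: "chordal_dist x y = chordal_dist y x"
  by (metis dist_commute dist_stereo)

lemma chordal_dist_triangle: "chordal_dist x z \<le> chordal_dist x y + chordal_dist y z"
  by (metis dist_triangle dist_stereo)

lemma chordal_dist_self [simp]: "chordal_dist x x = 0"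
  by (metis dist_self dist_stereo)

lemma inj_stereo: "inj stereo"
proof (rule injI)
  fix x y assume "stereo x = stereo y"
  then have "chordal_dist x y = 0" by (metis dist_self dist_stereo)
  then show "x = y"
    by (cases x; cases y) (auto simp: add_nonneg_eq_0_iff)
qed

lemma chordal_dist_Some_le: "chordal_dist (Some z) (Some w) \<le> 2 * norm (z - w)"
proof -
  have "sqrt (1 + (norm z)\<^sup>2) * sqrt (1 + (norm w)\<^sup>2) \<ge> 1 * 1"
    by (intro mult_mono) auto
  then show ?thesis
    by (simp add: divide_le_eq mult_left_le mult_le_cancel_left1)
qed

lemma continuous_map_stereo: "continuous_map riemann_sphere euclidean stereo"
  unfolding continuous_map_def
proof (intro conjI allI impI)
  fix V :: "(complex \<times> real) set"
  assume "openin euclidean V"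
  then have V: "open V" by simp
  have cont: "continuous_on UNIV (\<lambda>z. stereo (Some z))"
    by (auto intro!: continuous_intros simp: add_nonneg_eq_0_iff)
  have "open ((\<lambda>z. stereo (Some z)) -` V)"
    using open_vimage[OF V cont] .
  moreover have "\<exists>R. \<forall>z. norm z > R \<longrightarrow> stereo (Some z) \<in> V" if "stereo None \<in> V"
  proof -
    obtain e where e: "e > 0" "ball (stereo None) e \<subseteq> V" using V \<open>stereo None \<in> V\<close> openE by blast
    have "stereo (Some z) \<in> V" if z: "norm z > 2 / e" for z
    proof -
      have "norm z \<le> sqrt (1 + (norm z)\<^sup>2)" by (rule real_le_rsqrt) simp
      then have "2 / e < sqrt (1 + (norm z)\<^sup>2)" using z by linarith
      then have "chordal_dist None (Some z) < e"
        using e by (simp add: field_simps pos_divide_less_eq add_pos_nonneg)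
      then show ?thesis using e(2) by (auto simp: subset_iff simp flip: dist_stereo)
    qed
    then show ?thesis by blast
  qed
  ultimately show "openin riemann_sphere {x \<in> topspace riemann_sphere. stereo x \<in> V}"
    unfolding openin_riemann_sphere_iff by (simp add: vimage_def)
qed auto

text \<open>\<open>stereo\<close> is a continuous injection of a compact space into a Hausdorff
  space, hence an embedding. This ties the distance that defines normality to the topology that
  defines openness and connectedness.\<close>

lemma openin_riemann_sphere_chordal:
  "openin riemann_sphere U \<longleftrightarrow> (\<forall>x\<in>U. \<exists>e>0. \<forall>y. chordal_dist x y < e \<longrightarrow> y \<in> U)"
proof -
  have emb: "embedding_map riemann_sphere euclidean stereo"
    by (rule continuous_imp_embedding_map)
      (auto simp: compact_space_riemann_sphere continuous_map_stereo inj_stereo Hausdorff_space_euclidean)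
  have "openin riemann_sphere U \<longleftrightarrow> openin (top_of_set (range stereo)) (stereo ` U)"
    using emb homeomorphic_map_openness_eq[of riemann_sphere "top_of_set (range stereo)" stereo U]
    unfolding embedding_map_def by (auto simp: inj_image_subset_iff[OF inj_stereo] homeomorphic_map_openness)
  also have "\<dots> \<longleftrightarrow> (\<forall>x\<in>U. \<exists>e>0. \<forall>y. chordal_dist x y < e \<longrightarrow> y \<in> U)"
    unfolding openin_euclidean_subtopology_iff
    by (auto simp: dist_stereo inj_image_mem_iff[OF inj_stereo] chordal_dist_commute)
  finally show ?thesis .
qed

lemma openin_chordal_ball: "openin riemann_sphere {y. chordal_dist x y < e}"
  unfolding openin_riemann_sphere_chordal
proof safe
  fix y assume y: "chordal_dist x y < e"
  have "chordal_dist x z < e" if "chordal_dist y z < e - chordal_dist x y" for z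
    using that chordal_dist_triangle[of x z y] by linarith
  then show "\<exists>d>0. \<forall>z. chordal_dist y z < d \<longrightarrow> z \<in> {y. chordal_dist x y < e}"
    using y by (intro exI[of _ "e - chordal_dist x y"]) auto
qed

lemma compactin_closed_sphere: "closedin riemann_sphere K \<Longrightarrow> compactin riemann_sphere K"
  by (rule closedin_compact_space[OF compact_space_riemann_sphere])

lemma closedin_riemann_sphere_iff: "closedin riemann_sphere K \<longleftrightarrow> openin riemann_sphere (- K)"
  by (simp add: closedin_def Compl_eq_Diff_UNIV)

lemma compactin_chordal_cball: "compactin riemann_sphere {y. chordal_dist x y \<le> e}"
proof -
  have "openin riemann_sphere (- {y. chordal_dist x y \<le> e})"
    unfolding openin_riemann_sphere_chordal
  proof
    fix y assume "y \<in> - {y. chordal_dist x y \<le> e}"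
    then have y: "chordal_dist x y > e" by simp
    have "chordal_dist x z > e" if "chordal_dist y z < chordal_dist x y - e" for z
      using that chordal_dist_triangle[of x y z] chordal_dist_commute[of z y] by linarith
    then show "\<exists>d>0. \<forall>z. chordal_dist y z < d \<longrightarrow> z \<in> - {y. chordal_dist x y \<le> e}"
      using y by (intro exI[of _ "chordal_dist x y - e"]) (simp add: not_le)
  qed
  then show ?thesis by (simp add: compactin_closed_sphere closedin_riemann_sphere_iff)
qed

lemma openin_Some_image: "openin riemann_sphere (Some ` V) \<longleftrightarrow> open V"
  by (simp add: riemann_sphere_def)

lemma compactin_Some_image: "compact V \<Longrightarrow> compactin riemann_sphere (Some ` V)"
  unfolding riemann_sphere_def
  by (rule image_compactin[OF _ continuous_map_Some]) simp

lemma open_vimage_Some: "openin riemann_sphere U \<Longrightarrow> open (Some -` U)"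
  by (simp add: openin_riemann_sphere_iff)

lemma compact_vimage_Some:
  assumes "closedin riemann_sphere K" "None \<notin> K"
  shows "compact (Some -` K)"
proof -
  have o: "openin riemann_sphere (- K)" using assms by (simp add: closedin_riemann_sphere_iff)
  have "closed (Some -` K)"
    using open_vimage_Some[OF o] by (simp add: closed_def vimage_Compl)
  moreover obtain R where "\<forall>z. norm z > R \<longrightarrow> Some z \<notin> K"
    using o assms by (auto simp: openin_riemann_sphere_iff)
  then have "bounded (Some -` K)" by (auto simp: bounded_iff intro!: exI[of _ R]) (meson not_le)
  ultimately show ?thesis by (simp add: compact_eq_bounded_closed)
qed

section \<open>Normality\<close>

lemma normal_family_onE:
  assumes "normal_family_on U F" "\<And>n. f n \<in> F"
  obtains r g where "strict_mono (r :: nat \<Rightarrow> nat)"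
    "\<And>K \<epsilon>. compactin riemann_sphere K \<Longrightarrow> K \<subseteq> U \<Longrightarrow> \<epsilon> > 0 \<Longrightarrow>
       \<forall>\<^sub>F n in sequentially. \<forall>x\<in>K. chordal_dist (f (r n) x) (g x) < \<epsilon>"
proof -
  have "range f \<subseteq> F" using assms by auto
  then obtain r g where "strict_mono r \<and>
           (\<forall>K. compactin riemann_sphere K \<and> K \<subseteq> U \<longrightarrow>
              (\<forall>\<epsilon>>0. \<forall>\<^sub>F n in sequentially. \<forall>x\<in>K. chordal_dist (f (r n) x) (g x) < \<epsilon>))"
    using assms(1)[unfolded normal_family_on_def, rule_format, of f] by blast
  then show ?thesis using that[of r g] by blast
qed

lemma fatou_setI: "openin riemann_sphere U \<Longrightarrow> x \<in> U \<Longrightarrow> normal_family_on U {f ^^ n |n. n > 0} \<Longrightarrow> x \<in> fatou_set f"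
  by (auto simp: fatou_set_def)

lemma openin_fatou_set: "openin riemann_sphere (fatou_set f)"
proof (subst openin_subopen, safe)
  fix x assume "x \<in> fatou_set f"
  then obtain U where "openin riemann_sphere U" "x \<in> U" "normal_family_on U {f ^^ n |n. n > 0}"
    by (auto simp: fatou_set_def)
  then show "\<exists>T. openin riemann_sphere T \<and> x \<in> T \<and> T \<subseteq> fatou_set f"
    by (intro exI[of _ U]) (auto simp: fatou_set_def)
qed

lemma closedin_julia_set: "closedin riemann_sphere (julia_set f)"
  by (simp add: closedin_riemann_sphere_iff julia_set_def openin_fatou_set)

lemma continuous_map_funpow:
  "continuous_map X X f \<Longrightarrow> continuous_map X X (f ^^ n)"
  by (induction n) (auto intro: continuous_map_compose simp: id_def)

lemma continuous_map_chordal: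
  assumes "continuous_map riemann_sphere riemann_sphere f" "e > 0"
  shows "\<exists>V. openin riemann_sphere V \<and> x \<in> V \<and> (\<forall>y\<in>V. chordal_dist (f x) (f y) < e)"
  using openin_continuous_map_preimage[OF assms(1) openin_chordal_ball[of "f x" e]] assms(2)
  by (intro exI[of _ "{y. chordal_dist (f x) (f y) < e}"]) auto

text \<open>The limit map in the definition of normality is not assumed continuous. Equicontinuity
  comes from one fixed iterate that is already uniformly close to the limit on a compact ball and is
  itself continuous.\<close>

lemma fatou_equicontinuous:
  assumes f: "continuous_map riemann_sphere riemann_sphere f"
    and x: "x \<in> fatou_set f" and N: "\<And>k::nat. N k > (0::nat)"
  shows "\<exists>r. strict_mono r \<and> (\<forall>e>0. \<exists>V. openin riemann_sphere V \<and> x \<in> V \<and>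
           (\<forall>\<^sub>F k in sequentially. \<forall>y\<in>V. chordal_dist ((f ^^ N (r k)) x) ((f ^^ N (r k)) y) < e))"
proof -
  obtain U where U: "openin riemann_sphere U" "x \<in> U" and norm: "normal_family_on U {f ^^ n |n. n > 0}"
    using x by (auto simp: fatou_set_def)
  obtain d where d: "d > 0" "\<And>y. chordal_dist x y < d \<Longrightarrow> y \<in> U"
    using U by (auto simp: openin_riemann_sphere_chordal)
  define K where "K = {y. chordal_dist x y \<le> d/2}"
  have "f ^^ N k \<in> {f ^^ n |n. n > 0}" for k using N by auto
  then obtain r g where r: "strict_mono r" and
    g: "\<And>K \<epsilon>. compactin riemann_sphere K \<Longrightarrow> K \<subseteq> U \<Longrightarrow> \<epsilon> > 0 \<Longrightarrow>
         \<forall>\<^sub>F n in sequentially. \<forall>x\<in>K. chordal_dist ((f ^^ N (r n)) x) (g x) < \<epsilon>"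
    by (rule normal_family_onE[OF norm, of "\<lambda>k. f ^^ N k"]) blast
  have K: "compactin riemann_sphere K" "K \<subseteq> U"
    using d compactin_chordal_cball[of x "d/2"] by (auto simp: K_def)
  have xK: "x \<in> K" using d by (simp add: K_def)
  have "\<exists>V. openin riemann_sphere V \<and> x \<in> V \<and>
           (\<forall>\<^sub>F k in sequentially. \<forall>y\<in>V. chordal_dist ((f ^^ N (r k)) x) ((f ^^ N (r k)) y) < e)"
    if e: "e > 0" for e
  proof -
    \<comment> \<open>Five gaps are bridged: iterate k at x, limit at x, iterate n at x, iterate n
      at y, limit at y, iterate k at y.\<close>
    have ev: "\<forall>\<^sub>F n in sequentially. \<forall>x\<in>K. chordal_dist ((f ^^ N (r n)) x) (g x) < e/5"
      using g[OF K, of "e/5"] e by simp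
    then obtain n where n: "\<forall>x\<in>K. chordal_dist ((f ^^ N (r n)) x) (g x) < e/5"
      using eventually_happens'[OF sequentially_bot] by blast
    obtain V where V: "openin riemann_sphere V" "x \<in> V"
        "\<forall>y\<in>V. chordal_dist ((f ^^ N (r n)) x) ((f ^^ N (r n)) y) < e/5"
      using continuous_map_chordal[OF continuous_map_funpow[OF f], of "e/5" x "N (r n)"] e by auto
    define W where "W = V \<inter> {y. chordal_dist x y < d/2}"
    have W: "openin riemann_sphere W" "x \<in> W" "W \<subseteq> K"
      using V(1,2) d openin_Int[OF V(1) openin_chordal_ball[of x "d/2"]] unfolding W_def K_def by auto
    have "\<forall>y\<in>W. chordal_dist ((f ^^ N (r k)) x) ((f ^^ N (r k)) y) < e"
      if k: "\<forall>x\<in>K. chordal_dist ((f ^^ N (r k)) x) (g x) < e/5" for k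
    proof
      fix y assume y: "y \<in> W"
      then have yK: "y \<in> K" using W by auto
      have "chordal_dist ((f ^^ N (r n)) x) ((f ^^ N (r n)) y) < e/5"
        using V y by (auto simp: W_def)
      moreover have "chordal_dist ((f ^^ N (r k)) x) (g x) < e/5" "chordal_dist (g y) ((f ^^ N (r k)) y) < e/5"
        using k xK yK by (auto simp: chordal_dist_commute)
      moreover have "chordal_dist (g x) ((f ^^ N (r n)) x) < e/5" "chordal_dist ((f ^^ N (r n)) y) (g y) < e/5"
        using n xK yK by (auto simp: chordal_dist_commute)
      moreover have "chordal_dist ((f ^^ N (r k)) x) ((f ^^ N (r k)) y) \<le>
           chordal_dist ((f ^^ N (r k)) x) (g x) + chordal_dist (g x) ((f ^^ N (r n)) x)
         + chordal_dist ((f ^^ N (r n)) x) ((f ^^ N (r n)) y) + chordal_dist ((f ^^ N (r n)) y) (g y)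
         + chordal_dist (g y) ((f ^^ N (r k)) y)"
        by (meson add_mono chordal_dist_triangle order_refl order_trans)
      ultimately show "chordal_dist ((f ^^ N (r k)) x) ((f ^^ N (r k)) y) < e" by linarith
    qed
    then show ?thesis using W ev by (intro exI[of _ W]) (auto elim!: eventually_mono)
  qed
  then show ?thesis using r by blast
qed

lemma fatou_backward:
  assumes f: "continuous_map riemann_sphere riemann_sphere f" and x: "f x \<in> fatou_set f"
  shows "x \<in> fatou_set f"
proof -
  obtain U where U: "openin riemann_sphere U" "f x \<in> U" and norm: "normal_family_on U {f ^^ n |n. n > 0}"
    using x by (auto simp: fatou_set_def)
  define V where "V = {y \<in> topspace riemann_sphere. f y \<in> U}"
  have "normal_family_on V {f ^^ n |n. n > 0}"
    unfolding normal_family_on_def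
  proof (intro allI impI)
    fix h :: "nat \<Rightarrow> sphere \<Rightarrow> sphere" assume h: "range h \<subseteq> {f ^^ n |n. n > 0}"
    have "\<exists>m. h k = f ^^ Suc m" for k
    proof -
      have "h k \<in> {f ^^ n |n. n > 0}" using h by (rule range_subsetD)
      then obtain n where "h k = f ^^ n" "n > 0" by blast
      then show ?thesis by (metis gr0_conv_Suc)
    qed
    then obtain m where m: "\<And>k. h k = f ^^ Suc (m k)" by metis
    show "\<exists>r g. strict_mono r \<and> (\<forall>K. compactin riemann_sphere K \<and> K \<subseteq> V \<longrightarrow>
              (\<forall>\<epsilon>>0. \<forall>\<^sub>F n in sequentially. \<forall>x\<in>K. chordal_dist (h (r n) x) (g x) < \<epsilon>))"
    \<comment> \<open>The map \<open>f\<close> is \<open>f\<close> followed by the zeroth iterate,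
      which the family with n > 0 does not contain. If it occurs infinitely often, it is itself a
      constant subsequence.\<close>
    proof (cases "\<exists>\<^sub>F k in sequentially. m k = 0")
      case True
      then have inf: "infinite {k. m k = 0}" by (simp add: frequently_cofinite flip: cofinite_eq_sequentially)
      have "h (enumerate {k. m k = 0} n) = f" for n
        using enumerate_in_set[OF inf, of n] m by simp
      then show ?thesis
        by (intro exI[of _ "enumerate {k. m k = 0}"] exI[of _ f]) (auto simp: strict_mono_enumerate[OF inf])
    next
      case False
      then obtain k0 where k0: "\<And>k. k \<ge> k0 \<Longrightarrow> m k > 0"
        by (auto simp: frequently_def eventually_sequentially)
      have "f ^^ m (k + k0) \<in> {f ^^ n |n. n > 0}" for k using k0[of "k + k0"] by auto
      then obtain r g where r: "strict_mono r" and
        g: "\<And>K \<epsilon>. compactin riemann_sphere K \<Longrightarrow> K \<subseteq> U \<Longrightarrow> \<epsilon> > 0 \<Longrightarrow>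
             \<forall>\<^sub>F n in sequentially. \<forall>x\<in>K. chordal_dist ((f ^^ m (r n + k0)) x) (g x) < \<epsilon>"
        by (rule normal_family_onE[OF norm, of "\<lambda>k. f ^^ m (k + k0)"]) blast
      have "\<forall>\<^sub>F n in sequentially. \<forall>x\<in>K. chordal_dist (h (r n + k0) x) (g (f x)) < \<epsilon>"
        if K: "compactin riemann_sphere K" "K \<subseteq> V" "\<epsilon> > 0" for K \<epsilon>
      proof -
        have "compactin riemann_sphere (f ` K)" using K f image_compactin by blast
        then have "\<forall>\<^sub>F n in sequentially. \<forall>x\<in>f ` K. chordal_dist ((f ^^ m (r n + k0)) x) (g x) < \<epsilon>"
          using K by (intro g) (auto simp: V_def)
        then show ?thesis by eventually_elim (auto simp: m funpow_Suc_right simp del: funpow.simps)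
      qed
      moreover have "strict_mono (\<lambda>n. r n + k0)" using r by (simp add: strict_mono_def)
      ultimately show ?thesis by (intro exI[of _ "\<lambda>n. r n + k0"] exI[of _ "g \<circ> f"]) auto
    qed
  qed
  moreover have "openin riemann_sphere V" unfolding V_def using f U by (metis openin_continuous_map_preimage)
  moreover have "x \<in> V" using U by (simp add: V_def)
  ultimately show ?thesis using fatou_setI[of V x f] by blast
qed

text \<open>A section \<open>s\<close> of \<open>f\<close> over \<open>V\<close>, with values in the
  compact set \<open>B\<close>, transports the uniform limit from \<open>B\<close> to
  \<open>V\<close>. As limits may be arbitrary maps, \<open>s\<close> can be any choice of
  preimages.\<close>

lemma fatou_forward:
  assumes x: "x \<in> fatou_set f"
    and opn: "\<And>U. openin riemann_sphere U \<Longrightarrow> x \<in> U \<Longrightarrow>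
       \<exists>B V. compactin riemann_sphere B \<and> B \<subseteq> U \<and> openin riemann_sphere V \<and> f x \<in> V \<and> V \<subseteq> f ` B"
  shows "f x \<in> fatou_set f"
proof -
  obtain U where U: "openin riemann_sphere U" "x \<in> U" and norm: "normal_family_on U {f ^^ n |n. n > 0}"
    using x by (auto simp: fatou_set_def)
  obtain B V where BV: "compactin riemann_sphere B \<and> B \<subseteq> U \<and> openin riemann_sphere V \<and> f x \<in> V \<and> V \<subseteq> f ` B"
    using opn[OF U] by (elim exE)
  then have B: "compactin riemann_sphere B" "B \<subseteq> U" and V: "openin riemann_sphere V" "f x \<in> V"
    and VB: "V \<subseteq> f ` B" by blast+
  have "normal_family_on V {f ^^ n |n. n > 0}"
    unfolding normal_family_on_def
  proof (intro allI impI)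
    fix h :: "nat \<Rightarrow> sphere \<Rightarrow> sphere" assume h: "range h \<subseteq> {f ^^ n |n. n > 0}"
    have "\<exists>m>0. h k = f ^^ m" for k
    proof -
      have "h k \<in> {f ^^ n |n. n > 0}" using h by (rule range_subsetD)
      then show ?thesis by blast
    qed
    then obtain m where m: "\<And>k. m k > 0" "\<And>k. h k = f ^^ m k" by metis
    have "f ^^ Suc (m k) \<in> {f ^^ n |n. n > 0}" for k by blast
    then obtain r g where r: "strict_mono r" and
        g: "\<And>K \<epsilon>. compactin riemann_sphere K \<Longrightarrow> K \<subseteq> U \<Longrightarrow> \<epsilon> > 0 \<Longrightarrow>
             \<forall>\<^sub>F n in sequentially. \<forall>x\<in>K. chordal_dist ((f ^^ Suc (m (r n))) x) (g x) < \<epsilon>"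
      by (rule normal_family_onE[OF norm, of "\<lambda>k. f ^^ Suc (m k)"]) blast
    define s where "s y = (SOME x. x \<in> B \<and> f x = y)" for y
    have s: "s y \<in> B" "f (s y) = y" if "y \<in> V" for y
    proof -
      have "\<exists>x. x \<in> B \<and> f x = y" using that VB by blast
      from someI_ex[OF this] show "s y \<in> B" "f (s y) = y" by (auto simp: s_def)
    qed
    have "\<forall>\<^sub>F n in sequentially. \<forall>y\<in>K. chordal_dist (h (r n) y) (g (s y)) < \<epsilon>"
      if "K \<subseteq> V" "\<epsilon> > 0" for K \<epsilon>
      using g[OF B that(2)]
    proof eventually_elim
      case (elim n)
      show ?case
      proof
        fix y assume "y \<in> K"
        then have "y \<in> V" using that by auto
        then show "chordal_dist (h (r n) y) (g (s y)) < \<epsilon>"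
          using elim s[of y] by (auto simp: m funpow_Suc_right simp del: funpow.simps)
      qed
    qed
    then show "\<exists>r g. strict_mono r \<and> (\<forall>K. compactin riemann_sphere K \<and> K \<subseteq> V \<longrightarrow>
              (\<forall>\<epsilon>>0. \<forall>\<^sub>F n in sequentially. \<forall>x\<in>K. chordal_dist (h (r n) x) (g x) < \<epsilon>))"
      using r by (intro exI[of _ r] exI[of _ "g \<circ> s"]) auto
  qed
  then show ?thesis using V fatou_setI[of V "f x" f] by blast
qed

section \<open>Chebyshev's method for an even quartic\<close>

text \<open>At s = 1 + a this is (z^2 - 1)(z^2 - a). The parameter \<open>s\<close> is free because
  the same formulas at -s describe the imaginary axis; the type is free so that they serve the
  complex map and its real restrictions alike.\<close>

definition quartic :: "real \<Rightarrow> real \<Rightarrow> 'a::real_normed_field \<Rightarrow> 'a" where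
  "quartic s a z = z ^ 4 - of_real s * z\<^sup>2 + of_real a"

definition quartic' :: "real \<Rightarrow> 'a::real_normed_field \<Rightarrow> 'a" where
  "quartic' s z = 4 * z ^ 3 - 2 * of_real s * z"

definition quartic'' :: "real \<Rightarrow> 'a::real_normed_field \<Rightarrow> 'a" where
  "quartic'' s z = 12 * z\<^sup>2 - 2 * of_real s"

text \<open>The map \<open>cheb\<close> is \<open>z - (1 + L/2) p/p'\<close> with \<open>1 + L/2\<close> written as \<open>extraneous / (2 p'\<^sup>2)\<close>, so the zeros of
  \<open>extraneous\<close> are the fixed points of \<open>C\<close> other than the roots of \<open>p\<close> and infinity.\<close>

definition extraneous :: "real \<Rightarrow> real \<Rightarrow> 'a::real_normed_field \<Rightarrow> 'a" where
  "extraneous s a z = 2 * (quartic' s z)\<^sup>2 + quartic s a z * quartic'' s z"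

definition cheb :: "real \<Rightarrow> real \<Rightarrow> 'a::real_normed_field \<Rightarrow> 'a" where
  "cheb s a z = z - quartic s a z * extraneous s a z / (2 * quartic' s z ^ 3)"

text \<open>The known formula p^2 (3 p''^2 - p' p''') / (2 p'^4) for the derivative of Chebyshev's
  method, with the bracket expanded. The factor p^2 makes the simple roots of p
  superattracting.\<close>

definition cheb' :: "real \<Rightarrow> real \<Rightarrow> 'a::real_normed_field \<Rightarrow> 'a" where
  "cheb' s a z = 6 * (quartic s a z)\<^sup>2 * (28 * z ^ 4 - 8 * of_real s * z\<^sup>2 + (of_real s)\<^sup>2) / quartic' s z ^ 4"

text \<open>The quotient rule for z - p (2 p'^2 + p p'') / (2 p'^3), with 24 z as third derivative.
  The letters stay abstract so that the simplification never sees the quartic itself.\<close>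

lemma cheb'_aux:
  fixes p p1 p2 z :: "'a::field_char_0"
  assumes "p1 \<noteq> 0"
  shows "1 - ((p1 * (2 * p1\<^sup>2 + p * p2) + p * (4 * p1 * p2 + (p1 * p2 + p * (24 * z)))) * (2 * p1 ^ 3)
             - p * (2 * p1\<^sup>2 + p * p2) * (6 * p1\<^sup>2 * p2)) / (2 * p1 ^ 3 * (2 * p1 ^ 3))
         = p\<^sup>2 * (3 * p2\<^sup>2 - 24 * z * p1) / (2 * p1 ^ 4)"
  using assms by (simp add: field_simps) (simp add: algebra_simps eval_nat_numeral)

lemma has_field_derivative_cheb:
  fixes z :: "'a::real_normed_field"
  assumes nz: "quartic' s z \<noteq> 0"
  shows "(cheb s a has_field_derivative cheb' s a z) (at z)"
proof -
  have d0: "(quartic s a has_field_derivative quartic' s z) (at z)"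
    unfolding quartic_def quartic'_def
    by (auto intro!: derivative_eq_intros simp: algebra_simps)
  have d1: "(quartic' s has_field_derivative quartic'' s z) (at z)"
    unfolding quartic'_def quartic''_def
    by (auto intro!: derivative_eq_intros simp: algebra_simps)
  have d2: "(quartic'' s has_field_derivative 24 * z) (at z)"
    unfolding quartic''_def
    by (auto intro!: derivative_eq_intros simp: algebra_simps)
  have de: "(extraneous s a has_field_derivative
      (4 * quartic' s z * quartic'' s z + (quartic' s z * quartic'' s z + quartic s a z * (24 * z)))) (at z)"
    unfolding extraneous_def
    by (auto intro!: derivative_eq_intros d0 d1 d2 simp: algebra_simps)
  have dn: "((\<lambda>z. quartic s a z * extraneous s a z) has_field_derivative
      (quartic' s z * (2 * (quartic' s z)\<^sup>2 + quartic s a z * quartic'' s z) +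
       quartic s a z * (4 * quartic' s z * quartic'' s z + (quartic' s z * quartic'' s z + quartic s a z * (24 * z))))) (at z)"
    by (rule DERIV_cong[OF DERIV_mult[OF d0 de]]) (simp add: extraneous_def algebra_simps)
  have dd: "((\<lambda>z. 2 * quartic' s z ^ 3) has_field_derivative 6 * (quartic' s z)\<^sup>2 * quartic'' s z) (at z)"
    by (auto intro!: derivative_eq_intros d1 simp: algebra_simps)
  have "(cheb s a has_field_derivative
     (quartic s a z)\<^sup>2 * (3 * (quartic'' s z)\<^sup>2 - 24 * z * quartic' s z) / (2 * quartic' s z ^ 4)) (at z)"
    unfolding cheb_def
    by (rule DERIV_cong[OF DERIV_diff[OF DERIV_ident DERIV_divide[OF dn dd]]])
      (use nz cheb'_aux[OF nz, of "quartic s a z" "quartic'' s z" z] in \<open>simp_all add: extraneous_def\<close>)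
  moreover have "3 * (quartic'' s z)\<^sup>2 - 24 * z * quartic' s z =
      12 * (28 * z ^ 4 - 8 * of_real s * z\<^sup>2 + (of_real s)\<^sup>2)"
    unfolding quartic''_def quartic'_def
    by (simp add: algebra_simps power2_eq_square power3_eq_cube power4_eq_xxxx)
  moreover have "P * (12 * X) / (2 * Q) = 6 * P * X / Q" for P X Q :: 'a
    by (simp add: mult_ac)
  ultimately show ?thesis by (simp only: cheb'_def)
qed

lemma continuous_cheb:
  fixes z :: "'a::real_normed_field"
  shows "quartic' s z \<noteq> 0 \<Longrightarrow> isCont (cheb s a) z"
  by (rule DERIV_isCont[OF has_field_derivative_cheb])

lemma continuous_quartic' [continuous_intros]: "continuous_on A (quartic' s :: 'a::real_normed_field \<Rightarrow> 'a)"
  unfolding quartic'_def by (intro continuous_intros)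

lemma continuous_quartic [continuous_intros]: "continuous_on A (quartic s a :: 'a::real_normed_field \<Rightarrow> 'a)"
  unfolding quartic_def by (intro continuous_intros)

lemma continuous_extraneous [continuous_intros]: "continuous_on A (extraneous s a :: 'a::real_normed_field \<Rightarrow> 'a)"
  unfolding extraneous_def quartic''_def by (intro continuous_intros)

lemma quartic_uminus [simp]: "quartic s a (- z) = quartic s a z"
  by (simp add: quartic_def)

lemma quartic'_uminus [simp]: "quartic' s (- z) = - quartic' s z"
  by (simp add: quartic'_def)

lemma extraneous_uminus [simp]: "extraneous s a (- z) = extraneous s a z"
  by (simp add: extraneous_def) (simp add: quartic''_def)

lemma cheb_uminus [simp]: "cheb s a (- z) = - cheb s a z"
  by (simp add: cheb_def)

lemma cheb'_uminus [simp]: "cheb' s a (- z) = cheb' s a z"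
  by (simp add: cheb'_def)

text \<open>In degree 4, L tends to 3/4 and p / (z p') to 1/4, which gives 1 - (1 + 3/8) / 4 =
  21/32. Infinity is thus a fixed point of multiplier 32/21.\<close>

lemma tendsto_cheb_over:
  "((\<lambda>z::'a::real_normed_field. cheb s a z / z) \<longlongrightarrow> 21/32) at_infinity"
proof -
  define h :: "'a \<Rightarrow> 'a" where "h u = 1 - (1 - of_real s * u\<^sup>2 + of_real a * u ^ 4) *
     (2 * (4 - 2 * of_real s * u\<^sup>2)\<^sup>2 + (1 - of_real s * u\<^sup>2 + of_real a * u ^ 4) * (12 - 2 * of_real s * u\<^sup>2)) /
     (2 * (4 - 2 * of_real s * u\<^sup>2) ^ 3)" for u
  have "((\<lambda>z. h (inverse z)) \<longlongrightarrow> h 0) at_infinity"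
    unfolding h_def
    by (intro tendsto_intros tendsto_inverse_0) auto
  then have lim: "((\<lambda>z. h (inverse z)) \<longlongrightarrow> 21/32) at_infinity"
    by (simp add: h_def)
  have eq: "cheb s a z / z = h (inverse z)" if z: "z \<noteq> 0" for z
  proof -
    define u P Q R where "u = inverse z" and "P = 1 - of_real s * u\<^sup>2 + of_real a * u ^ 4"
      and "Q = 4 - 2 * of_real s * u\<^sup>2" and "R = 12 - 2 * of_real s * u\<^sup>2"
    have 1: "quartic s a z = P * z ^ 4" "quartic' s z = Q * z ^ 3" "quartic'' s z = R * z ^ 2"
      unfolding quartic_def quartic'_def quartic''_def P_def Q_def R_def u_def
      using z by (simp_all add: field_simps power2_eq_square power3_eq_cube power4_eq_xxxx)
    have "cheb s a z / z = 1 - P * (2 * Q\<^sup>2 + P * R) / (2 * Q ^ 3)"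
      unfolding cheb_def extraneous_def 1
      using z by (cases "Q = 0") (simp_all add: field_simps eval_nat_numeral)
    also have "\<dots> = h (inverse z)"
      by (simp add: h_def P_def Q_def R_def u_def)
    finally show ?thesis .
  qed
  have "eventually (\<lambda>z::'a. z \<noteq> 0) at_infinity"
    unfolding eventually_at_infinity by (intro exI[of _ 1]) auto
  then have "eventually (\<lambda>z. h (inverse z) = cheb s a z / z) at_infinity"
    by eventually_elim (simp add: eq)
  then show ?thesis using lim by (rule Lim_transform_eventually[rotated])
qed

text \<open>The two factors enclose 21/32. The upper one drives large orbits inwards; the lower one
  keeps them from jumping over an annulus whose outer radius is at least twice the inner
  one.\<close>

lemma cheb_near_infinity:
  obtains R where "R > 0" "\<And>z::'a::real_normed_field. norm z \<ge> R \<Longrightarrow>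
     norm (cheb s a z) \<ge> norm z / 2 \<and> norm (cheb s a z) \<le> 3/4 * norm z"
proof -
  have "((\<lambda>z::'a. norm (cheb s a z / z)) \<longlongrightarrow> norm (21/32 :: 'a)) at_infinity"
    by (intro tendsto_norm tendsto_cheb_over)
  then have lim: "((\<lambda>z::'a. norm (cheb s a z / z)) \<longlongrightarrow> 21/32) at_infinity"
    by (simp add: norm_divide)
  have "eventually (\<lambda>z::'a. norm (cheb s a z / z) > 1/2 \<and> norm (cheb s a z / z) < 3/4) at_infinity"
    by (intro eventually_conj order_tendstoD[OF lim]) auto
  then obtain b where b: "\<And>z::'a. norm z \<ge> b \<Longrightarrow> norm (cheb s a z / z) > 1/2 \<and> norm (cheb s a z / z) < 3/4"
    unfolding eventually_at_infinity by blast
  show ?thesis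
  proof (rule that[of "max b 1"])
    fix z :: 'a assume z: "norm z \<ge> max b 1"
    then have "norm z > 0" "norm z \<ge> b" by auto
    with b[of z] show "norm (cheb s a z) \<ge> norm z / 2 \<and> norm (cheb s a z) \<le> 3/4 * norm z"
      by (auto simp: norm_divide field_simps)
  qed auto
qed

section \<open>Identification of the rational map\<close>

text \<open>The reduced pair satisfies \<open>P * D = N * Q\<close>. Neither pair has a common zero,
  so \<open>Q\<close> and \<open>D\<close> vanish at the same points; comparing degrees, the excess
  of numerator over denominator agrees too.\<close>

lemma rat_map_Fract:
  assumes D: "D \<noteq> 0" and cop: "\<And>z. poly D z = 0 \<Longrightarrow> poly N z \<noteq> 0"
  shows "rat_map (to_fract N / to_fract D) (Some z) = (if poly D z = 0 then None else Some (poly N z / poly D z))"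
    and "degree N > degree D \<Longrightarrow> rat_map (to_fract N / to_fract D) None = None"
proof -
  define R where "R = to_fract N / to_fract D"
  define P Q where "P = fst (quot_of_fract R)" and "Q = snd (quot_of_fract R)"
  have PQ: "quot_of_fract R = (P, Q)" by (simp add: P_def Q_def)
  have Q0: "Q \<noteq> 0" by (simp add: Q_def)
  have "coprime P Q" unfolding P_def Q_def by (rule coprime_quot_of_fract)
  have "Fract P Q = Fract N D"
    using D by (simp add: P_def Q_def R_def to_fract_def)
  then have eq: "P * D = N * Q" using D Q0 by (simp add: eq_fract)
  have pe: "poly P z * poly D z = poly N z * poly Q z" for z
    using arg_cong[OF eq, of "\<lambda>p. poly p z"] by simp
  have cop': "poly Q z = 0 \<Longrightarrow> poly P z \<noteq> 0" for z
    using \<open>coprime P Q\<close> coprime_common_divisor[of P Q "[:-z, 1:]"] by (auto simp: poly_eq_0_iff_dvd is_unit_iff_degree)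
  have iff: "poly Q z = 0 \<longleftrightarrow> poly D z = 0" for z
    using pe[of z] cop[of z] cop'[of z] by auto
  show "rat_map (to_fract N / to_fract D) (Some z) = (if poly D z = 0 then None else Some (poly N z / poly D z))"
    using pe[of z] iff[of z] unfolding R_def[symmetric] rat_map_def PQ
    by (auto simp: field_simps)
  assume deg: "degree N > degree D"
  then have "N \<noteq> 0" by auto
  then have "P \<noteq> 0" using eq Q0 by auto
  have "degree P + degree D = degree N + degree Q"
    using arg_cong[OF eq, of degree] D Q0 \<open>N \<noteq> 0\<close> \<open>P \<noteq> 0\<close> by (simp add: degree_mult_eq)
  then have "degree P > degree Q" using deg by linarith
  then show "rat_map (to_fract N / to_fract D) None = None"
    unfolding R_def[symmetric] rat_map_def PQ by simp
qed

lemma chebyshev_method_Fract: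
  assumes "pderiv p \<noteq> 0"
  shows "chebyshev_method p =
     to_fract ([:0, 2:] * pderiv p ^ 3 - p * (2 * (pderiv p)\<^sup>2 + p * pderiv (pderiv p))) / to_fract (2 * pderiv p ^ 3)"
proof -
  define x y w v where "x = to_fract [:0, 1::complex:]" and "y = to_fract p"
    and "w = to_fract (pderiv p)" and "v = to_fract (pderiv (pderiv p))"
  have w: "w \<noteq> 0" using assms by (simp add: w_def)
  have two: "to_fract (2 :: complex poly) = 2" by (metis one_add_one to_fract_1 to_fract_add)
  then have two0: "(2 :: complex poly fract) \<noteq> 0" by (metis to_fract_eq_0_iff zero_neq_numeral)
  have "[:0, 2:] = 2 * [:0, 1::complex:]" by (simp add: numeral_poly)
  then have x2: "to_fract [:0, 2::complex:] = 2 * x" by (simp only: to_fract_mult two x_def)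
  have pw: "to_fract (r ^ n) = to_fract r ^ n" for r :: "complex poly" and n
    by (induction n) simp_all
  show ?thesis
    unfolding chebyshev_method_def chebyshev_L_def
    unfolding to_fract_mult to_fract_diff to_fract_add pw two x2
    unfolding x_def[symmetric] y_def[symmetric] w_def[symmetric] v_def[symmetric]
    using w two0 by (simp add: field_simps power2_eq_square power3_eq_cube)
qed


locale chebyshev_quartic =
  fixes a :: real
  assumes a: "-1 < a" "a < 1" "a \<noteq> 0"
begin

abbreviation C :: "sphere \<Rightarrow> sphere" where "C \<equiv> C_map a"
abbreviation c :: "complex \<Rightarrow> complex" where "c \<equiv> cheb (1 + a) a"
abbreviation pole :: "complex \<Rightarrow> bool" where "pole z \<equiv> quartic' (1 + a) z = 0"

text \<open>The quartic is a at 0 and -(1 - a)^2 / 4 at the other critical points. So numerator and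
  denominator of the map do not cancel, and every critical point of the quartic is a pole of the
  map.\<close>

lemma pole_imp:
  assumes "pole z"
  shows "quartic (1 + a) a z \<noteq> 0" "quartic'' (1 + a) z \<noteq> 0"
proof -
  have "2 * z * (2 * z\<^sup>2 - of_real (1 + a)) = 0"
    using assms by (simp add: quartic'_def algebra_simps power2_eq_square power3_eq_cube)
  then have "z = 0 \<or> 2 * z\<^sup>2 = of_real (1 + a)" by simp
  then consider "z = 0" | "z\<^sup>2 = of_real ((1 + a) / 2)" by (auto simp: field_simps)
  then have "quartic (1 + a) a z \<noteq> 0 \<and> quartic'' (1 + a) z \<noteq> 0"
  proof cases
    case 1
    then show ?thesis using a by (auto simp: quartic_def quartic''_def complex_eq_iff)
  next
    case 2
    have z4: "z ^ 4 = (z\<^sup>2)\<^sup>2" by simp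
    have "quartic (1 + a) a z = of_real (- (1 - a)\<^sup>2 / 4)"
      unfolding quartic_def z4 2 by (simp add: field_simps power2_eq_square)
    moreover have "quartic'' (1 + a) z = of_real (4 * (1 + a))"
      unfolding quartic''_def 2 by simp
    ultimately show ?thesis using a
      by (metis divide_eq_0_iff mult_eq_0_iff neg_equal_0_iff_equal of_real_eq_0_iff power_eq_0_iff
          right_minus_eq zero_neq_numeral add_eq_0_iff less_irrefl)
  qed
  then show "quartic (1 + a) a z \<noteq> 0" "quartic'' (1 + a) z \<noteq> 0" by auto
qed

lemma C_simps: "C None = None" "C (Some z) = (if pole z then None else Some (c z))"
proof -
  define p where "p = p_poly a"
  define N where "N = [:0, 2:] * pderiv p ^ 3 - p * (2 * (pderiv p)\<^sup>2 + p * pderiv (pderiv p))"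
  define D where "D = 2 * pderiv p ^ 3"
  have p: "p = [:of_real a, 0, - of_real (1 + a), 0, 1:]"
    by (simp add: p_def p_poly_def)
  have p': "pderiv p = [:0, - 2 * of_real (1 + a), 0, 4:]"
    by (simp add: p pderiv_pCons)
  have p'': "pderiv (pderiv p) = [:- 2 * of_real (1 + a), 0, 12:]"
    by (simp add: p' pderiv_pCons)
  have e0: "poly p z = quartic (1 + a) a z" for z
    by (simp add: p quartic_def algebra_simps power2_eq_square power4_eq_xxxx)
  have e1: "poly (pderiv p) z = quartic' (1 + a) z" for z
    by (simp add: p' quartic'_def algebra_simps power3_eq_cube)
  have e2: "poly (pderiv (pderiv p)) z = quartic'' (1 + a) z" for z
    by (simp add: p'' quartic''_def algebra_simps power2_eq_square)
  have pnz: "pderiv p \<noteq> 0" by (simp add: p')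
  have C: "C = rat_map (to_fract N / to_fract D)"
    unfolding C_map_def N_def D_def p_def[symmetric] chebyshev_method_Fract[OF pnz] ..
  have D0: "D \<noteq> 0" using pnz by (simp add: D_def)
  have eD: "poly D z = 2 * quartic' (1 + a) z ^ 3" for z
    by (simp add: D_def e1)
  have eN: "poly N z = 2 * z * quartic' (1 + a) z ^ 3 - quartic (1 + a) a z * extraneous (1 + a) a z" for z
    by (simp add: N_def e0 e1 e2 extraneous_def)
  have cop: "poly N z \<noteq> 0" if "poly D z = 0" for z
    using that pole_imp[of z] by (simp add: eN eD extraneous_def)
  show "C (Some z) = (if pole z then None else Some (c z))"
  proof -
    have "C (Some z) = (if poly D z = 0 then None else Some (poly N z / poly D z))"
      unfolding C using D0 cop by (rule rat_map_Fract(1))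
    then show ?thesis unfolding eD eN by (auto simp: cheb_def field_simps)
  qed
  \<comment> \<open>Leading coefficients: 2 * 4^3 - (2 * 4^2 + 12) = 84. The numerator has degree at
    least 10 against 9, so infinity is fixed.\<close>
  have "coeff N 10 = 84"
    unfolding N_def p'' unfolding p' unfolding p
    by (simp add: power2_eq_square power3_eq_cube numeral_poly eval_nat_numeral)
  then have "degree N \<ge> 10" by (intro le_degree) simp
  moreover have "degree D = 9"
    unfolding D_def by (simp add: degree_mult_eq degree_power_eq pnz) (simp add: p')
  ultimately have deg: "degree N > degree D" by simp
  show "C None = None" unfolding C using D0 cop deg by (rule rat_map_Fract(2))
qed

end

section \<open>Montel's normality criterion\<close>

text \<open>Inversion is a chordal isometry; the junk value \<open>inverse 0 = 0\<close> is replaced by infinity.\<close>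

definition sphere_inv :: "complex \<Rightarrow> sphere" where
  "sphere_inv z = (if z = 0 then None else Some (inverse z))"

lemma chordal_dist_sphere_inv: "chordal_dist (sphere_inv z) (sphere_inv w) = chordal_dist (Some z) (Some w)"
proof -
  have fin: "sqrt (1 + (norm (inverse u))\<^sup>2) = sqrt (1 + (norm u)\<^sup>2) / norm u" if "u \<noteq> 0" for u :: complex
  proof -
    have "1 + (norm (inverse u))\<^sup>2 = (1 + (norm u)\<^sup>2) / (norm u)\<^sup>2"
      using that by (simp add: norm_inverse norm_divide field_simps power_divide)
    then show ?thesis by (simp add: real_sqrt_divide)
  qed
  have "norm (inverse z - inverse w) = norm (z - w) / (norm z * norm w)" if "z \<noteq> 0" "w \<noteq> 0"
    using that by (simp add: inverse_diff_inverse norm_mult norm_divide norm_inverse norm_minus_commute field_simps)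
  then show ?thesis
    by (cases "z = 0"; cases "w = 0") (simp_all add: sphere_inv_def fin)
qed

lemma Schottky_ball:
  fixes h :: "complex \<Rightarrow> complex"
  assumes "R > 0" "h holomorphic_on cball \<xi> R" "\<And>z. z \<in> cball \<xi> R \<Longrightarrow> h z \<noteq> 0 \<and> h z \<noteq> 1"
    and "norm (h \<xi>) \<le> 1" "z \<in> cball \<xi> (R/2)"
  shows "norm (h z) \<le> exp (pi * exp (pi * 16))"
proof -
  define f where "f = (\<lambda>u. h (\<xi> + of_real R * u))"
  have *: "\<xi> + of_real R * u \<in> cball \<xi> R" if "u \<in> cball 0 1" for u
    using that assms(1) by (simp add: dist_norm norm_mult mult_left_le)
  have holf: "f holomorphic_on cball 0 1"
    unfolding f_def
    by (rule holomorphic_on_compose_gen[OF _ assms(2), unfolded o_def])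
      (use * in \<open>auto intro!: holomorphic_intros\<close>)
  define u where "u = (z - \<xi>) / of_real R"
  have u: "norm u \<le> 1/2"
    using assms(1,5) by (simp add: u_def norm_divide dist_norm norm_minus_commute field_simps)
  \<comment> \<open>Schottky's bound for a central value of modulus at most 1 and relative radius
    1/2; the inner exponent evaluates to 16 pi.\<close>
  have "norm (f u) \<le> exp (pi * exp (pi * (2 + 2 * 1 + 12 * (1/2) / (1 - 1/2))))"
    by (rule Schottky[OF holf]) (use assms * u in \<open>auto simp: f_def\<close>)
  moreover have "f u = h z" using assms(1) by (simp add: f_def u_def)
  ultimately show ?thesis by simp
qed

text \<open>Schottky's theorem bounds all \<open>h n\<close> on the half disc by one constant, so
  Montel's theorem for bounded families applies.\<close>

lemma Montel_omit_01:
  fixes h :: "nat \<Rightarrow> complex \<Rightarrow> complex"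
  assumes R: "R > 0" and hol: "\<And>n. h n holomorphic_on cball \<xi> R"
    and om: "\<And>n z. z \<in> cball \<xi> R \<Longrightarrow> h n z \<noteq> 0 \<and> h n z \<noteq> 1"
    and b: "\<And>n. norm (h n \<xi>) \<le> 1"
  obtains g r where "strict_mono (r :: nat \<Rightarrow> nat)"
    "\<And>K. compact K \<Longrightarrow> K \<subseteq> ball \<xi> (R/2) \<Longrightarrow> uniform_limit K (h \<circ> r) g sequentially"
proof -
  have sub: "ball \<xi> (R/2) \<subseteq> cball \<xi> (R/2)" "ball \<xi> (R/2) \<subseteq> cball \<xi> R" using R by auto
  show ?thesis
  proof (rule Montel[of "ball \<xi> (R/2)" "range h" h])
    show "f holomorphic_on ball \<xi> (R/2)" if "f \<in> range h" for f
      using that hol sub by (auto intro: holomorphic_on_subset)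
    show "\<exists>B. \<forall>f\<in>range h. \<forall>z\<in>K. norm (f z) \<le> B" if "K \<subseteq> ball \<xi> (R/2)" for K
    proof (intro exI ballI)
      fix f z assume "f \<in> range h" "z \<in> K"
      then obtain n where "f = h n" by auto
      moreover have "z \<in> cball \<xi> (R/2)" using \<open>z \<in> K\<close> that sub by blast
      ultimately show "norm (f z) \<le> exp (pi * exp (pi * 16))"
        using Schottky_ball[OF R hol om b] by auto
    qed
    fix g :: "complex \<Rightarrow> complex" and r :: "nat \<Rightarrow> nat"
    assume "strict_mono r" "\<And>K. compact K \<Longrightarrow> K \<subseteq> ball \<xi> (R/2) \<Longrightarrow> uniform_limit K (h \<circ> r) g sequentially"
    then show ?thesis by (rule that)
  qed auto
qed

text \<open>If the central values are bounded by |q| infinitely often, the functions h / q omit 0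
  and 1 and are normalised for \<open>Montel_omit_01\<close>. Otherwise q / h does so eventually,
  and inversion, a chordal isometry, carries the convergence back; the limit may then take the value
  infinity.\<close>

lemma Montel_chordal:
  fixes h :: "nat \<Rightarrow> complex \<Rightarrow> complex"
  assumes R: "R > 0" and hol: "\<And>n. h n holomorphic_on cball \<xi> R"
    and om: "\<And>n z. z \<in> cball \<xi> R \<Longrightarrow> h n z \<noteq> 0 \<and> h n z \<noteq> q" and q: "q \<noteq> 0"
  shows "\<exists>r g. strict_mono (r :: nat \<Rightarrow> nat) \<and> (\<forall>K. compact K \<and> K \<subseteq> ball \<xi> (R/2) \<longrightarrow>
     (\<forall>\<epsilon>>0. \<forall>\<^sub>F n in sequentially. \<forall>z\<in>K. chordal_dist (Some (h (r n) z)) (g z) < \<epsilon>))"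
proof (cases "\<exists>\<^sub>F n in sequentially. norm (h n \<xi>) \<le> norm q")
  case True
  then have inf: "infinite {n. norm (h n \<xi>) \<le> norm q}"
    by (simp add: frequently_cofinite flip: cofinite_eq_sequentially)
  define t where "t = enumerate {n. norm (h n \<xi>) \<le> norm q}"
  have t: "strict_mono t" "\<And>n. norm (h (t n) \<xi>) \<le> norm q"
    using strict_mono_enumerate[OF inf] enumerate_in_set[OF inf] by (auto simp: t_def)
  obtain g r where r: "strict_mono (r :: nat \<Rightarrow> nat)" and
    g: "\<And>K. compact K \<Longrightarrow> K \<subseteq> ball \<xi> (R/2) \<Longrightarrow>
          uniform_limit K ((\<lambda>n z. h (t n) z / q) \<circ> r) g sequentially"
  proof (rule Montel_omit_01[OF R, of "\<lambda>n z. h (t n) z / q" \<xi>])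
    show "(\<lambda>z. h (t n) z / q) holomorphic_on cball \<xi> R" for n
      using hol q by (auto intro!: holomorphic_intros)
    show "h (t n) z / q \<noteq> 0 \<and> h (t n) z / q \<noteq> 1" if "z \<in> cball \<xi> R" for n z
      using om[OF that] q by auto
    show "norm (h (t n) \<xi> / q) \<le> 1" for n
      using t(2)[of n] q by (simp add: norm_divide divide_le_eq)
  qed (rule that)
  have "\<forall>\<^sub>F n in sequentially. \<forall>z\<in>K. chordal_dist (Some (h (t (r n)) z)) (Some (q * g z)) < \<epsilon>"
    if K: "compact K" "K \<subseteq> ball \<xi> (R/2)" "\<epsilon> > 0" for K \<epsilon>
  proof -
    have "\<epsilon> / (2 * norm q) > 0" using K q by simp
    with g[OF K(1,2)] have "\<forall>\<^sub>F n in sequentially. \<forall>z\<in>K. dist (h (t (r n)) z / q) (g z) < \<epsilon> / (2 * norm q)"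
      unfolding uniform_limit_iff by simp
    then show ?thesis
    proof eventually_elim
      case (elim n)
      show ?case
      proof
        fix z assume "z \<in> K"
        have "h (t (r n)) z - q * g z = q * (h (t (r n)) z / q - g z)" using q by (simp add: algebra_simps)
        then have "norm (h (t (r n)) z - q * g z) = norm q * dist (h (t (r n)) z / q) (g z)"
          by (simp add: norm_mult dist_norm)
        also have "\<dots> < norm q * (\<epsilon> / (2 * norm q))"
          using elim \<open>z \<in> K\<close> q by (intro mult_strict_left_mono) auto
        finally have "2 * norm (h (t (r n)) z - q * g z) < \<epsilon>" using q by (simp add: field_simps)
        then show "chordal_dist (Some (h (t (r n)) z)) (Some (q * g z)) < \<epsilon>"
          using chordal_dist_Some_le le_less_trans by blast
      qed
    qed
  qed
  moreover have "strict_mono (t \<circ> r)" using t r by (simp add: strict_mono_o)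
  ultimately show ?thesis
    by (intro exI[of _ "t \<circ> r"] exI[of _ "\<lambda>z. Some (q * g z)"]) auto
next
  case False
  then have "\<forall>\<^sub>F n in sequentially. norm (h n \<xi>) > norm q"
    by (simp add: not_frequently not_le)
  then obtain n0 where n0: "\<And>n. n \<ge> n0 \<Longrightarrow> norm (h n \<xi>) > norm q"
    unfolding eventually_sequentially by blast
  obtain g r where r: "strict_mono (r :: nat \<Rightarrow> nat)" and
    g: "\<And>K. compact K \<Longrightarrow> K \<subseteq> ball \<xi> (R/2) \<Longrightarrow>
          uniform_limit K ((\<lambda>n z. q / h (n + n0) z) \<circ> r) g sequentially"
  proof (rule Montel_omit_01[OF R, of "\<lambda>n z. q / h (n + n0) z" \<xi>])
    show "(\<lambda>z. q / h (n + n0) z) holomorphic_on cball \<xi> R" for n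
      using hol om by (auto intro!: holomorphic_intros)
    show "q / h (n + n0) z \<noteq> 0 \<and> q / h (n + n0) z \<noteq> 1" if "z \<in> cball \<xi> R" for n z
      using om[OF that, of "n + n0"] q by (auto simp: divide_eq_1_iff)
    show "norm (q / h (n + n0) \<xi>) \<le> 1" for n
      using n0[of "n + n0"] by (simp add: norm_divide divide_le_eq)
  qed (rule that)
  have "\<forall>\<^sub>F n in sequentially. \<forall>z\<in>K. chordal_dist (Some (h (r n + n0) z)) (sphere_inv (g z / q)) < \<epsilon>"
    if K: "compact K" "K \<subseteq> ball \<xi> (R/2)" "\<epsilon> > 0" for K \<epsilon>
  proof -
    have "\<epsilon> * norm q / 2 > 0" using K q by simp
    with g[OF K(1,2)] have "\<forall>\<^sub>F n in sequentially. \<forall>z\<in>K. dist (q / h (r n + n0) z) (g z) < \<epsilon> * norm q / 2"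
      unfolding uniform_limit_iff o_def by blast
    then show ?thesis
    proof eventually_elim
      case (elim n)
      show ?case
      proof
        fix z assume z: "z \<in> K"
        have "z \<in> cball \<xi> R" using z K R by auto
        then have nz: "h (r n + n0) z \<noteq> 0" using om by blast
        have "1 / h (r n + n0) z - g z / q = (q / h (r n + n0) z - g z) / q"
          using q by (simp add: diff_divide_distrib)
        then have "norm (1 / h (r n + n0) z - g z / q) = dist (q / h (r n + n0) z) (g z) / norm q"
          by (simp add: norm_divide dist_norm)
        also have "\<dots> < (\<epsilon> * norm q / 2) / norm q"
          using elim z q by (intro divide_strict_right_mono) auto
        finally have "2 * norm (1 / h (r n + n0) z - g z / q) < \<epsilon>" using q by simp
        then have "chordal_dist (Some (1 / h (r n + n0) z)) (Some (g z / q)) < \<epsilon>"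
          using chordal_dist_Some_le le_less_trans by blast
        then have "chordal_dist (sphere_inv (1 / h (r n + n0) z)) (sphere_inv (g z / q)) < \<epsilon>"
          by (simp only: chordal_dist_sphere_inv)
        then show "chordal_dist (Some (h (r n + n0) z)) (sphere_inv (g z / q)) < \<epsilon>"
          using nz by (simp add: sphere_inv_def)
      qed
    qed
  qed
  moreover have "strict_mono (\<lambda>n. r n + n0)" using r by (simp add: strict_mono_def)
  ultimately show ?thesis
    by (intro exI[of _ "\<lambda>n. r n + n0"] exI[of _ "\<lambda>z. sphere_inv (g z / q)"]) auto
qed

lemma compact_vimage_Some_compactin:
  assumes "compactin riemann_sphere K" "K \<subseteq> Some ` A"
  shows "compact (Some -` K)"
  using assms compactin_imp_closedin[OF Hausdorff_space_riemann_sphere]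
  by (intro compact_vimage_Some) auto

text \<open>Infinity is the third omitted value: it is encoded in the assumption that all iterates
  are finite on the disc.\<close>

lemma fatou_if_omits:
  assumes R: "R > 0" and hol: "\<And>n. h n holomorphic_on cball \<xi> R"
    and f: "\<And>n z. z \<in> cball \<xi> R \<Longrightarrow> (f ^^ n) (Some z) = Some (h n z)"
    and om: "\<And>n z. z \<in> cball \<xi> R \<Longrightarrow> h n z \<noteq> 0 \<and> h n z \<noteq> q" and q: "q \<noteq> 0"
  shows "Some \<xi> \<in> fatou_set f"
proof -
  define U where "U = Some ` ball \<xi> (R/2)"
  have "normal_family_on U {f ^^ n |n. n > 0}"
    unfolding normal_family_on_def
  proof (intro allI impI)
    fix F :: "nat \<Rightarrow> sphere \<Rightarrow> sphere" assume F: "range F \<subseteq> {f ^^ n |n. n > 0}"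
    have "\<exists>m. F k = f ^^ m" for k
    proof -
      have "F k \<in> {f ^^ n |n. n > 0}" using F by (rule range_subsetD)
      then show ?thesis by blast
    qed
    then obtain m where m: "\<And>k. F k = f ^^ m k" by metis
    have "\<exists>r g. strict_mono (r :: nat \<Rightarrow> nat) \<and> (\<forall>K. compact K \<and> K \<subseteq> ball \<xi> (R/2) \<longrightarrow>
        (\<forall>\<epsilon>>0. \<forall>\<^sub>F n in sequentially. \<forall>z\<in>K. chordal_dist (Some (h (m (r n)) z)) (g z) < \<epsilon>))"
      by (rule Montel_chordal[OF R hol _ q]) (rule om)
    then obtain r g where "strict_mono (r :: nat \<Rightarrow> nat) \<and> (\<forall>K. compact K \<and> K \<subseteq> ball \<xi> (R/2) \<longrightarrow>
        (\<forall>\<epsilon>>0. \<forall>\<^sub>F n in sequentially. \<forall>z\<in>K. chordal_dist (Some (h (m (r n)) z)) (g z) < \<epsilon>))"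
      by (elim exE)
    then have r: "strict_mono r" and g: "\<And>K \<epsilon>. compact K \<Longrightarrow> K \<subseteq> ball \<xi> (R/2) \<Longrightarrow> \<epsilon> > 0 \<Longrightarrow>
        \<forall>\<^sub>F n in sequentially. \<forall>z\<in>K. chordal_dist (Some (h (m (r n)) z)) (g z) < \<epsilon>"
      by blast+
    have "\<forall>\<^sub>F n in sequentially. \<forall>x\<in>K. chordal_dist (F (r n) x) (g (the x)) < \<epsilon>"
      if K: "compactin riemann_sphere K" "K \<subseteq> U" "\<epsilon> > 0" for K \<epsilon>
    proof -
      define K' where "K' = Some -` K"
      have K': "compact K'" "K' \<subseteq> ball \<xi> (R/2)" "K = Some ` K'"
        using K compact_vimage_Some_compactin[OF K(1)] by (auto simp: K'_def U_def)
      from g[OF K'(1,2) K(3)] show ?thesis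
      proof eventually_elim
        case (elim n)
        have "z \<in> cball \<xi> R" if "z \<in> K'" for z
          using that K'(2) R by auto
        then show ?case using elim by (auto simp: K'(3) m f)
      qed
    qed
    then show "\<exists>r g. strict_mono r \<and> (\<forall>K. compactin riemann_sphere K \<and> K \<subseteq> U \<longrightarrow>
              (\<forall>\<epsilon>>0. \<forall>\<^sub>F n in sequentially. \<forall>x\<in>K. chordal_dist (F (r n) x) (g x) < \<epsilon>))"
      using r by (intro exI[of _ r] exI[of _ "\<lambda>x. g (the x)"]) auto
  qed
  moreover have "openin riemann_sphere U" by (simp add: U_def openin_Some_image)
  moreover have "Some \<xi> \<in> U" using R by (simp add: U_def)
  ultimately show ?thesis using fatou_setI[of U "Some \<xi>" f] by blast
qed

section \<open>The Chebyshev map on the sphere\<close>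

lemma cheb_of_real: "cheb s a (of_real x) = of_real (cheb s a x)"
  by (simp add: cheb_def extraneous_def quartic_def quartic'_def quartic''_def)

lemma quartic'_of_real: "quartic' s (of_real x) = of_real (quartic' s x)"
  by (simp add: quartic'_def)

section \<open>Monotone iteration on a real interval\<close>

lemma decreasing_iterates:
  fixes f :: "real \<Rightarrow> real"
  assumes cont: "\<And>x. x \<in> {e..u} \<Longrightarrow> isCont f x" and f: "\<And>x. x \<in> {e<..u} \<Longrightarrow> e \<le> f x \<and> f x < x"
    and fe: "f e = e" and x: "x \<in> {e..u}"
  shows "(\<lambda>n. (f ^^ n) x) \<longlonglongrightarrow> e" "(f ^^ n) x \<in> {e..u}"
proof -
  define X where "X = (\<lambda>n. (f ^^ n) x)"
  have f': "e \<le> f x \<and> f x \<le> x" if "x \<in> {e..u}" for x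
    using f[of x] fe that by (cases "x = e") auto
  have X: "X n \<in> {e..u}" for n
    by (induction n) (use x f' in \<open>force simp: X_def\<close>)+
  then show "(f ^^ n) x \<in> {e..u}" by (simp add: X_def)
  have "decseq X"
    unfolding decseq_Suc_iff using f' X by (simp add: X_def)
  moreover have "\<And>n. e \<le> X n" using X by simp
  ultimately obtain L where L: "X \<longlonglongrightarrow> L" "\<And>n. L \<le> X n" by (metis decseq_convergent)
  have "e \<le> L" using L X by (meson LIMSEQ_le_const atLeastAtMost_iff)
  moreover have "L \<le> u" using L(2)[of 0] X[of 0] by auto
  ultimately have Lin: "L \<in> {e..u}" by simp
  have "(\<lambda>n. f (X n)) \<longlonglongrightarrow> f L"
    using isCont_tendsto_compose[OF cont[OF Lin] L(1)] .
  moreover have "(\<lambda>n. f (X n)) \<longlonglongrightarrow> L"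
    using LIMSEQ_Suc[OF L(1)] by (simp add: X_def)
  ultimately have "f L = L" by (rule LIMSEQ_unique)
  then have "L = e" using f[of L] Lin by (cases "L = e") auto
  then show "(\<lambda>n. (f ^^ n) x) \<longlonglongrightarrow> e" using L by (simp add: X_def)
qed

lemma increasing_iterates:
  fixes f :: "real \<Rightarrow> real"
  assumes cont: "\<And>x. x \<in> {l..e} \<Longrightarrow> isCont f x" and f: "\<And>x. x \<in> {l..<e} \<Longrightarrow> f x \<le> e \<and> x < f x"
    and fe: "f e = e" and x: "x \<in> {l..e}"
  shows "(\<lambda>n. (f ^^ n) x) \<longlonglongrightarrow> e" "(f ^^ n) x \<in> {l..e}"
proof -
  define g where "g = (\<lambda>x. - f (- x))"
  have gn: "(g ^^ n) (- x) = - (f ^^ n) x" for n by (induction n) (simp_all add: g_def)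
  have c: "isCont g y" if y: "y \<in> {- e..- l}" for y
  proof -
    have "isCont f (- y)" using cont y by simp
    then have "isCont (\<lambda>x. f (- x)) y" by (rule isCont_o2[rotated]) simp
    then show ?thesis by (simp add: g_def)
  qed
  have g: "- e \<le> g y \<and> g y < y" if y: "y \<in> {- e<..- l}" for y
    using f[of "- y"] y by (auto simp: g_def)
  have "g (- e) = - e" "- x \<in> {- e..- l}" using fe x by (auto simp: g_def)
  note D = decreasing_iterates[where f = g and e = "- e" and u = "- l" and x = "- x", OF c g this]
  have "- (f ^^ n) x \<in> {- e..- l}" for n using D(2)[where n = n] unfolding gn .
  then have "- e \<le> - (f ^^ n) x \<and> - (f ^^ n) x \<le> - l" by (simp only: atLeastAtMost_iff)
  then show "(f ^^ n) x \<in> {l..e}" by simp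
  have "(\<lambda>n. - (f ^^ n) x) \<longlonglongrightarrow> - e" using D(1) unfolding gn .
  from tendsto_minus[OF this] show "(\<lambda>n. (f ^^ n) x) \<longlonglongrightarrow> e" by simp
qed

section \<open>The symmetry z to -z on the sphere\<close>

abbreviation neg :: "sphere \<Rightarrow> sphere" where "neg \<equiv> map_option uminus"

lemma neg_neg [simp]: "neg (neg x) = x" by (cases x) auto

lemma chordal_dist_neg [simp]: "chordal_dist (neg x) (neg y) = chordal_dist x y"
  by (cases x; cases y) (auto simp: norm_minus_commute)

lemma continuous_map_neg: "continuous_map riemann_sphere riemann_sphere neg"
  unfolding continuous_map_def
proof (intro conjI allI impI)
  fix U assume U: "openin riemann_sphere U"
  show "openin riemann_sphere {x \<in> topspace riemann_sphere. neg x \<in> U}"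
    unfolding openin_riemann_sphere_chordal
  proof safe
    fix x assume "neg x \<in> U"
    then obtain e where e: "e > 0" "\<And>y. chordal_dist (neg x) y < e \<Longrightarrow> y \<in> U"
      using U unfolding openin_riemann_sphere_chordal by blast
    have "neg y \<in> U" if "chordal_dist x y < e" for y
      using e(2)[of "neg y"] that by simp
    then show "\<exists>e>0. \<forall>y. chordal_dist x y < e \<longrightarrow> y \<in> {x \<in> topspace riemann_sphere. neg x \<in> U}"
      using e(1) by auto
  qed
qed auto

lemma fatou_neg:
  assumes f: "\<And>x. f (neg x) = neg (f x)" and x: "x \<in> fatou_set f"
  shows "neg x \<in> fatou_set f"
proof -
  have fn: "(f ^^ n) (neg x) = neg ((f ^^ n) x)" for n x by (induction n) (simp_all add: f)
  obtain U where U: "openin riemann_sphere U" "x \<in> U" and norm: "normal_family_on U {f ^^ n |n. n > 0}"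
    using x by (auto simp: fatou_set_def)
  define V where "V = {y \<in> topspace riemann_sphere. neg y \<in> U}"
  have "normal_family_on V {f ^^ n |n. n > 0}"
    unfolding normal_family_on_def
  proof (intro allI impI)
    fix h :: "nat \<Rightarrow> sphere \<Rightarrow> sphere" assume h: "range h \<subseteq> {f ^^ n |n. n > 0}"
    have hk: "h k \<in> {f ^^ n |n. n > 0}" for k using h by (rule range_subsetD)
    then obtain r g where r: "strict_mono r" and
        g: "\<And>K \<epsilon>. compactin riemann_sphere K \<Longrightarrow> K \<subseteq> U \<Longrightarrow> \<epsilon> > 0 \<Longrightarrow>
             \<forall>\<^sub>F n in sequentially. \<forall>x\<in>K. chordal_dist (h (r n) x) (g x) < \<epsilon>"
      by (rule normal_family_onE[OF norm, of h]) blast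
    have hn: "h k (neg x) = neg (h k x)" for k x using hk[of k] fn by auto
    have "\<forall>\<^sub>F n in sequentially. \<forall>x\<in>K. chordal_dist (h (r n) x) (neg (g (neg x))) < \<epsilon>"
      if K: "compactin riemann_sphere K" "K \<subseteq> V" "\<epsilon> > 0" for K \<epsilon>
    proof -
      have "compactin riemann_sphere (neg ` K)" using K continuous_map_neg image_compactin by blast
      moreover have "neg ` K \<subseteq> U" using K by (auto simp: V_def)
      ultimately have "\<forall>\<^sub>F n in sequentially. \<forall>x\<in>neg ` K. chordal_dist (h (r n) x) (g x) < \<epsilon>"
        using K(3) by (rule g)
      then show ?thesis
      proof eventually_elim
        case (elim n)
        show ?case
        proof
          fix x assume "x \<in> K"
          then have "chordal_dist (neg (h (r n) x)) (g (neg x)) < \<epsilon>" using elim by (auto simp: hn)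
          then show "chordal_dist (h (r n) x) (neg (g (neg x))) < \<epsilon>"
            using chordal_dist_neg[of "h (r n) x" "neg (g (neg x))"] by simp
        qed
      qed
    qed
    then show "\<exists>r g. strict_mono r \<and> (\<forall>K. compactin riemann_sphere K \<and> K \<subseteq> V \<longrightarrow>
              (\<forall>\<epsilon>>0. \<forall>\<^sub>F n in sequentially. \<forall>x\<in>K. chordal_dist (h (r n) x) (g x) < \<epsilon>))"
      using r by (intro exI[of _ r] exI[of _ "\<lambda>x. neg (g (neg x))"]) blast
  qed
  moreover have "openin riemann_sphere V" unfolding V_def using continuous_map_neg U(1) by (rule openin_continuous_map_preimage)
  moreover have "neg x \<in> V" using U by (simp add: V_def)
  ultimately show ?thesis using fatou_setI[of V "neg x" f] by blast
qed

section \<open>Continuity and openness of the map\<close>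

context chebyshev_quartic
begin

lemma finite_poles: "finite {z. pole z}"
proof -
  have "{z. pole z} = {z. poly [:0, - 2 * of_real (1 + a), 0, 4:] z = 0}"
    by (auto simp: quartic'_def algebra_simps power3_eq_cube)
  moreover have "finite {z. poly [:0, - 2 * of_real (1 + a), 0, 4:] (z::complex) = 0}"
    by (rule poly_roots_finite) simp
  ultimately show ?thesis by (simp only:)
qed

lemma nonpoles_eq: "{z. \<not> pole z} = UNIV - {z. pole z}" by auto

lemma open_nonpoles: "open {z. \<not> pole z}"
  unfolding nonpoles_eq by (intro open_Diff finite_imp_closed finite_poles) auto

lemma eventually_nonpole: "eventually (\<lambda>w. \<not> pole w) (at z)"
proof -
  have "\<not> z islimpt {z. pole z}" using finite_poles by (simp add: islimpt_finite)
  then show ?thesis by (simp add: islimpt_iff_eventually)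
qed

lemma holomorphic_c: "c holomorphic_on {z. \<not> pole z}"
  unfolding holomorphic_on_open[OF open_nonpoles] using has_field_derivative_cheb by blast

lemma c_root: "quartic (1 + a) a e = 0 \<Longrightarrow> c e = e"
  by (simp add: cheb_def)

lemma quartic_one: "quartic (1 + a) a (1 :: 'a :: real_normed_field) = 0"
  by (simp add: quartic_def)

lemma open_map_c:
  assumes "open U" "\<And>z. z \<in> U \<Longrightarrow> \<not> pole z"
  shows "open (c ` U)"
proof (rule open_mapping_thm[OF holomorphic_c open_nonpoles _ assms(1)])
  show "connected {z. \<not> pole z}"
    unfolding nonpoles_eq by (rule connected_open_delete_finite) (auto simp: finite_poles)
  \<comment> \<open>Two distinct fixed points exclude that the map is constant.\<close>
  have c1: "c 1 = 1" "c (- 1) = - 1" using quartic_one[where 'a = complex] by (simp_all add: c_root)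
  have np: "\<not> pole 1" "\<not> pole (- 1)" using quartic_one[where 'a = complex] pole_imp by fastforce+
  show "\<not> c constant_on {z. \<not> pole z}"
  proof
    assume "c constant_on {z. \<not> pole z}"
    then obtain y where y: "\<And>x. \<not> pole x \<Longrightarrow> c x = y" by (auto simp: constant_on_def)
    have "c 1 = c (- 1)" using y[OF np(1)] y[OF np(2)] by simp
    then show False using c1 by simp
  qed
qed (use assms in auto)

lemma filterlim_c_pole:
  assumes "pole e"
  shows "filterlim c at_infinity (at e)"
proof -
  define N where "N = (\<lambda>z::complex. 2 * z * quartic' (1 + a) z ^ 3 - quartic (1 + a) a z * extraneous (1 + a) a z)"
  define D where "D = (\<lambda>z::complex. 2 * quartic' (1 + a) z ^ 3)"
  have "continuous_on UNIV N" unfolding N_def by (intro continuous_intros)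
  then have "isCont N e" by (simp add: continuous_on_eq_continuous_at)
  then have N: "(N \<longlongrightarrow> N e) (at e)" by (simp add: isCont_def)
  have "continuous_on UNIV D" unfolding D_def by (intro continuous_intros)
  then have "isCont D e" by (simp add: continuous_on_eq_continuous_at)
  then have D: "(D \<longlongrightarrow> 0) (at e)" using assms by (simp add: isCont_def D_def)
  have "filterlim D (at 0) (at e)"
    unfolding filterlim_at using D eventually_nonpole[of e] by (auto elim!: eventually_mono simp: D_def)
  moreover have "N e \<noteq> 0" using pole_imp[OF assms] assms by (simp add: N_def extraneous_def)
  ultimately have "filterlim (\<lambda>z. N z / D z) at_infinity (at e)"
    using N by (intro filterlim_divide_at_infinity)
  moreover have "eventually (\<lambda>z. N z / D z = c z) (at e)"
    using eventually_nonpole[of e]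
  proof eventually_elim
    case (elim z)
    then show ?case by (simp add: N_def D_def cheb_def diff_divide_distrib)
  qed
  ultimately show ?thesis
    using filterlim_cong[OF refl refl, of "\<lambda>z. N z / D z" c "at e" at_infinity] by blast
qed

lemma continuous_C: "continuous_map riemann_sphere riemann_sphere C"
  unfolding continuous_map_def
proof (intro conjI allI impI)
  fix U assume U: "openin riemann_sphere U"
  define W where "W = {x \<in> topspace riemann_sphere. C x \<in> U}"
  have V: "open (Some -` U)" using U by (rule open_vimage_Some)
  have ev: "eventually (\<lambda>w. w \<in> Some -` W) (nhds z)" if z: "z \<in> Some -` W" for z
  proof (cases "pole z")
    case False
    then have "c z \<in> Some -` U" using z by (simp add: W_def C_simps)
    moreover have "(c \<longlongrightarrow> c z) (nhds z)"
      using continuous_cheb[OF False] by (simp add: isCont_def tendsto_at_iff_tendsto_nhds)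
    ultimately have "eventually (\<lambda>w. c w \<in> Some -` U) (nhds z)"
      using V by (auto dest: topological_tendstoD)
    moreover have "eventually (\<lambda>w. w \<in> {z. \<not> pole z}) (nhds z)"
      using False open_nonpoles by (intro eventually_nhds_in_open) auto
    ultimately show ?thesis by eventually_elim (simp add: W_def C_simps)
  next
    case True
    then have N: "None \<in> U" using z by (simp add: W_def C_simps)
    then obtain R where R: "\<And>z. norm z > R \<Longrightarrow> Some z \<in> U"
      using U by (auto simp: openin_riemann_sphere_iff)
    have "filterlim (\<lambda>w. norm (c w)) at_top (at z)"
      using filterlim_c_pole[OF True] filterlim_at_infinity_imp_norm_at_top by blast
    then have "eventually (\<lambda>w. norm (c w) > R) (at z)" by (simp add: filterlim_at_top_dense)
    then have "eventually (\<lambda>w. w \<in> Some -` W) (at z)"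
      by eventually_elim (use R N in \<open>simp add: W_def C_simps\<close>)
    then show ?thesis using z by (simp add: eventually_nhds_conv_at)
  qed
  have "\<exists>T. open T \<and> z \<in> T \<and> T \<subseteq> Some -` W" if zW: "z \<in> Some -` W" for z
  proof -
    obtain T where "open T" "z \<in> T" "\<And>w. w \<in> T \<Longrightarrow> w \<in> Some -` W"
      using ev[OF zW] unfolding eventually_nhds by auto
    then show ?thesis by (intro exI[of _ T]) auto
  qed
  then have "open (Some -` W)" using open_subopen[of "Some -` W"] by simp
  moreover have "\<exists>R. \<forall>z. norm z > R \<longrightarrow> Some z \<in> W" if "None \<in> W"
  proof -
    have N: "None \<in> U" using that by (simp add: W_def C_simps)
    then obtain R where R: "\<And>z. norm z > R \<Longrightarrow> Some z \<in> U"
      using U by (auto simp: openin_riemann_sphere_iff)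
    obtain R0 where "R0 > 0" and R0: "\<And>z::complex. norm z \<ge> R0 \<Longrightarrow>
        norm (c z) \<ge> norm z / 2 \<and> norm (c z) \<le> 3/4 * norm z"
      by (rule cheb_near_infinity[where 'a = complex]) (rule that)
    have "Some z \<in> W" if "norm z > max R0 (2 * R)" for z
      using that R0[of z] R[of "c z"] N by (auto simp: W_def C_simps)
    then show ?thesis by blast
  qed
  ultimately show "openin riemann_sphere {x \<in> topspace riemann_sphere. C x \<in> U}"
    unfolding openin_riemann_sphere_iff W_def[symmetric] by blast
qed auto

lemma C_neg: "C (neg x) = neg (C x)"
  by (cases x) (auto simp: C_simps)

lemma funpow_C_neg: "(C ^^ n) (neg x) = neg ((C ^^ n) x)"
  by (induction n) (auto simp: C_neg)

lemma funpow_C_None: "(C ^^ n) None = None"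
  by (induction n) (auto simp: C_simps)

lemma funpow_C_Some:
  "(C ^^ n) (Some z) \<noteq> None \<Longrightarrow> (C ^^ n) (Some z) = Some ((c ^^ n) z)"
proof (induction n)
  case (Suc n)
  have "(C ^^ n) (Some z) \<noteq> None"
  proof
    assume "(C ^^ n) (Some z) = None"
    then have "(C ^^ Suc n) (Some z) = None" by (simp add: C_simps)
    with Suc.prems show False by blast
  qed
  with Suc show ?case by (auto simp: C_simps split: if_splits)
qed auto

lemma funpow_C_Some_nonpole:
  "(\<And>k. k < n \<Longrightarrow> \<not> pole ((c ^^ k) z)) \<Longrightarrow> (C ^^ n) (Some z) = Some ((c ^^ n) z)"
  by (induction n) (auto simp: C_simps)

subsection \<open>Basins of the roots\<close>

text \<open>The whole basin, not only the component containing \<open>e\<close>. The chordal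
  distance also makes sense of orbits that reach infinity.\<close>

definition basin :: "complex \<Rightarrow> sphere set" where
  "basin e = {x. (\<lambda>n. chordal_dist ((C ^^ n) x) (Some e)) \<longlonglongrightarrow> 0}"

lemma basin_C: "C x \<in> basin e \<longleftrightarrow> x \<in> basin e"
proof -
  have "(C ^^ n) (C x) = (C ^^ Suc n) x" for n by (simp add: funpow_swap1)
  then show ?thesis unfolding basin_def
    using filterlim_sequentially_Suc[of "\<lambda>n. chordal_dist ((C ^^ n) x) (Some e)" "nhds 0"] by simp
qed

lemma basin_funpow: "(C ^^ n) x \<in> basin e \<longleftrightarrow> x \<in> basin e"
  by (induction n) (auto simp: basin_C)

lemma basinI:
  assumes "\<And>n. \<not> pole ((c ^^ n) z)" "(\<lambda>n. (c ^^ n) z) \<longlonglongrightarrow> e"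
  shows "Some z \<in> basin e"
proof -
  have "(\<lambda>n. 2 * norm ((c ^^ n) z - e)) \<longlonglongrightarrow> 2 * norm (e - e)"
    by (intro tendsto_intros assms(2))
  then have lim: "(\<lambda>n. 2 * norm ((c ^^ n) z - e)) \<longlonglongrightarrow> 0" by simp
  show ?thesis unfolding basin_def
  proof (intro CollectI tendsto_sandwich[OF _ _ tendsto_const lim] always_eventually allI)
    fix n
    show "0 \<le> chordal_dist ((C ^^ n) (Some z)) (Some e)"
      by (metis dist_stereo zero_le_dist)
    show "chordal_dist ((C ^^ n) (Some z)) (Some e) \<le> 2 * norm ((c ^^ n) z - e)"
      using assms(1) chordal_dist_Some_le by (simp add: funpow_C_Some_nonpole)
  qed
qed

lemma basin_unique: "x \<in> basin e \<Longrightarrow> x \<in> basin e' \<Longrightarrow> e = e'"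
proof -
  assume x: "x \<in> basin e" "x \<in> basin e'"
  have "(\<lambda>n. stereo ((C ^^ n) x)) \<longlonglongrightarrow> stereo (Some e)" "(\<lambda>n. stereo ((C ^^ n) x)) \<longlonglongrightarrow> stereo (Some e')"
    using x unfolding basin_def tendsto_dist_iff[of _ "stereo _"] dist_stereo by auto
  then have "stereo (Some e) = stereo (Some e')" by (rule LIMSEQ_unique)
  then have "Some e = Some e'" by (rule injD[OF inj_stereo])
  then show "e = e'" by simp
qed

lemma basin_neg: "x \<in> basin e \<Longrightarrow> neg x \<in> basin (- e)"
proof -
  have "chordal_dist ((C ^^ n) (neg x)) (Some (- e)) = chordal_dist ((C ^^ n) x) (Some e)" for n
    using chordal_dist_neg[of "(C ^^ n) x" "Some e"] by (simp add: funpow_C_neg)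
  then show "x \<in> basin e \<Longrightarrow> neg x \<in> basin (- e)" unfolding basin_def by simp
qed

text \<open>The derivative vanishes at a root, so in a small disc each step at least halves the
  distance to it.\<close>

lemma basin_trap:
  assumes e: "quartic (1 + a) a e = 0"
  shows "\<exists>r>0. \<forall>z\<in>ball e r. Some z \<in> basin e"
proof -
  have np: "\<not> pole e" using e pole_imp by blast
  have "(c has_field_derivative 0) (at e)"
    using has_field_derivative_cheb[OF np, of a] e by (simp add: cheb'_def)
  then have "((\<lambda>z. (c z - c e) / (z - e)) \<longlongrightarrow> 0) (at e)"
    by (simp add: has_field_derivative_iff)
  then have "eventually (\<lambda>z. dist ((c z - c e) / (z - e)) 0 < 1/2) (at e)"
    by (rule tendstoD) simp
  moreover have "eventually (\<lambda>z. \<not> pole z) (at e)" by (rule eventually_nonpole)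
  ultimately have "eventually (\<lambda>z. \<not> pole z \<and> norm (c z - e) \<le> norm (z - e) / 2) (at e)"
    using eventually_neq_at_within[of e e UNIV]
    by eventually_elim (auto simp: norm_divide c_root[OF e] field_simps)
  then have "eventually (\<lambda>z. \<not> pole z \<and> norm (c z - e) \<le> norm (z - e) / 2) (nhds e)"
    using np by (simp add: eventually_nhds_conv_at c_root[OF e])
  then obtain r where r: "r > 0" "\<And>z. dist z e < r \<Longrightarrow> \<not> pole z \<and> norm (c z - e) \<le> norm (z - e) / 2"
    unfolding eventually_nhds_metric by blast
  have "Some z \<in> basin e" if z: "z \<in> ball e r" for z
  proof -
    have b: "norm ((c ^^ n) z - e) \<le> norm (z - e) * (1/2) ^ n" for n
    proof (induction n)
      case (Suc n)
      have "norm (z - e) * (1/2) ^ n \<le> norm (z - e)"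
        by (simp add: mult_left_le power_le_one)
      then have "dist ((c ^^ n) z) e < r"
        using Suc z by (simp add: dist_norm norm_minus_commute)
      then show ?case using r(2)[of "(c ^^ n) z"] Suc by simp
    qed simp
    have np: "\<not> pole ((c ^^ n) z)" for n
    proof -
      have "norm (z - e) * (1/2) ^ n \<le> norm (z - e)"
        by (simp add: mult_left_le power_le_one)
      then have "dist ((c ^^ n) z) e < r"
        using b[of n] z by (simp add: dist_norm norm_minus_commute)
      then show ?thesis using r(2) by blast
    qed
    have "(\<lambda>n. norm (z - e) * (1/2) ^ n) \<longlonglongrightarrow> norm (z - e) * 0"
      by (intro tendsto_intros LIMSEQ_power_zero) simp
    then have "(\<lambda>n. norm ((c ^^ n) z - e)) \<longlonglongrightarrow> 0"
      by - (rule tendsto_0_le[where K = 1], auto simp: b intro!: always_eventually)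
    then have "(\<lambda>n. (c ^^ n) z - e) \<longlonglongrightarrow> 0" by (rule tendsto_norm_zero_cancel)
    then have "(\<lambda>n. (c ^^ n) z) \<longlonglongrightarrow> e" by (rule LIM_zero_cancel)
    show ?thesis by (rule basinI[OF np]) fact
  qed
  with r(1) show ?thesis by (intro exI[of _ r]) simp
qed

lemma basin_chordal_trap:
  assumes e: "quartic (1 + a) a e = 0"
  obtains d where "d > 0" "\<And>x. chordal_dist x (Some e) < d \<Longrightarrow> x \<in> basin e"
proof -
  obtain r where r: "r > 0" "\<And>z. z \<in> ball e r \<Longrightarrow> Some z \<in> basin e" using basin_trap[OF e] by blast
  have "openin riemann_sphere (Some ` ball e r)" by (simp add: openin_Some_image)
  moreover have "Some e \<in> Some ` ball e r" using r(1) by simp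
  ultimately obtain d where d: "d > 0" "\<And>y. chordal_dist (Some e) y < d \<Longrightarrow> y \<in> Some ` ball e r"
    unfolding openin_riemann_sphere_chordal by blast
  show ?thesis
  proof (rule that[OF d(1)])
    fix x assume "chordal_dist x (Some e) < d"
    then have "x \<in> Some ` ball e r" by (intro d(2)) (simp add: chordal_dist_commute)
    then show "x \<in> basin e" using r(2) by blast
  qed
qed

lemma openin_basin:
  assumes e: "quartic (1 + a) a e = 0"
  shows "openin riemann_sphere (basin e)"
proof (subst openin_subopen, intro ballI)
  fix x assume x: "x \<in> basin e"
  obtain d where d: "d > 0" "\<And>x. chordal_dist x (Some e) < d \<Longrightarrow> x \<in> basin e"
    by (rule basin_chordal_trap[OF e]) (rule that)
  have "eventually (\<lambda>n. chordal_dist ((C ^^ n) x) (Some e) < d) sequentially"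
    using x d(1) unfolding basin_def by (auto dest: order_tendstoD)
  then obtain n where n: "chordal_dist ((C ^^ n) x) (Some e) < d"
    using eventually_happens'[OF sequentially_bot] by blast
  define T where "T = {y \<in> topspace riemann_sphere. (C ^^ n) y \<in> {y. chordal_dist (Some e) y < d}}"
  have "openin riemann_sphere T" unfolding T_def
    using continuous_map_funpow[OF continuous_C] openin_chordal_ball by (rule openin_continuous_map_preimage)
  moreover have "x \<in> T" using n by (simp add: T_def chordal_dist_commute)
  moreover have "T \<subseteq> basin e"
  proof
    fix y assume "y \<in> T"
    then have "(C ^^ n) y \<in> basin e" by (intro d(2)) (simp add: T_def chordal_dist_commute)
    then show "y \<in> basin e" by (simp add: basin_funpow)
  qed
  ultimately show "\<exists>T. openin riemann_sphere T \<and> x \<in> T \<and> T \<subseteq> basin e" by blast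
qed

text \<open>By equicontinuity some nearby \<open>w\<close> in the basin has iterates within d/2 of
  those of \<open>x\<close>, along a subsequence. The iterates of \<open>w\<close> come within d/2
  of \<open>e\<close>, so one iterate of \<open>x\<close> enters the trapping disc.\<close>

lemma fatou_closure_basin:
  assumes e: "quartic (1 + a) a e = 0" and x: "x \<in> fatou_set C"
    and cl: "\<And>V. openin riemann_sphere V \<Longrightarrow> x \<in> V \<Longrightarrow> V \<inter> basin e \<noteq> {}"
  shows "x \<in> basin e"
proof -
  obtain d where d: "d > 0" "\<And>x. chordal_dist x (Some e) < d \<Longrightarrow> x \<in> basin e"
    by (rule basin_chordal_trap[OF e]) (rule that)
  obtain r where "strict_mono r \<and> (\<forall>\<epsilon>>0. \<exists>V. openin riemann_sphere V \<and> x \<in> V \<and>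
       (\<forall>\<^sub>F k in sequentially. \<forall>y\<in>V. chordal_dist ((C ^^ Suc (r k)) x) ((C ^^ Suc (r k)) y) < \<epsilon>))"
    using fatou_equicontinuous[OF continuous_C x, of Suc, OF zero_less_Suc] by (elim exE)
  then have r: "strict_mono r" and V: "\<And>\<epsilon>. \<epsilon> > 0 \<Longrightarrow> \<exists>V. openin riemann_sphere V \<and> x \<in> V \<and>
       (\<forall>\<^sub>F k in sequentially. \<forall>y\<in>V. chordal_dist ((C ^^ Suc (r k)) x) ((C ^^ Suc (r k)) y) < \<epsilon>)"
    by blast+
  obtain V where V: "openin riemann_sphere V" "x \<in> V"
       "\<forall>\<^sub>F k in sequentially. \<forall>y\<in>V. chordal_dist ((C ^^ Suc (r k)) x) ((C ^^ Suc (r k)) y) < d/2"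
  proof -
    obtain V where "openin riemann_sphere V \<and> x \<in> V \<and>
       (\<forall>\<^sub>F k in sequentially. \<forall>y\<in>V. chordal_dist ((C ^^ Suc (r k)) x) ((C ^^ Suc (r k)) y) < d/2)"
      using V[OF half_gt_zero[OF d(1)]] by (elim exE)
    then show ?thesis using that by blast
  qed
  obtain w where w: "w \<in> V" "w \<in> basin e" using cl[OF V(1,2)] by blast
  have "filterlim (\<lambda>k. Suc (r k)) sequentially sequentially"
    using filterlim_subseq[OF r] by (rule filterlim_compose[OF filterlim_Suc])
  then have "(\<lambda>k. chordal_dist ((C ^^ Suc (r k)) w) (Some e)) \<longlonglongrightarrow> 0"
    using w(2) unfolding basin_def mem_Collect_eq by (rule filterlim_compose[rotated])
  then have "\<forall>\<^sub>F k in sequentially. chordal_dist ((C ^^ Suc (r k)) w) (Some e) < d/2"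
    using half_gt_zero[OF d(1)] by (rule order_tendstoD(2))
  with V(3) have "\<forall>\<^sub>F k in sequentially. chordal_dist ((C ^^ Suc (r k)) x) (Some e) < d"
  proof eventually_elim
    case (elim k)
    then have "chordal_dist ((C ^^ Suc (r k)) x) ((C ^^ Suc (r k)) w) < d/2" using w(1) by blast
    then show ?case using elim(2) chordal_dist_triangle[of "(C ^^ Suc (r k)) x" "Some e" "(C ^^ Suc (r k)) w"]
      by linarith
  qed
  then obtain k where "chordal_dist ((C ^^ Suc (r k)) x) (Some e) < d"
    using eventually_happens'[OF sequentially_bot] by blast
  then have "(C ^^ Suc (r k)) x \<in> basin e" by (rule d(2))
  then show ?thesis by (simp only: basin_funpow)
qed

text \<open>A basin is open and, by \<open>fatou_closure_basin\<close>, relatively closed in the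
  Fatou set, so a connected set of Fatou points cannot leave it.\<close>

lemma connected_fatou_basin:
  assumes e: "quartic (1 + a) a e = 0" and \<Gamma>: "connected \<Gamma>" "Some ` \<Gamma> \<subseteq> fatou_set C"
    and z: "z \<in> \<Gamma>" "Some z \<in> basin e" and w: "w \<in> \<Gamma>"
  shows "Some w \<in> basin e"
proof (rule ccontr)
  assume nw: "Some w \<notin> basin e"
  define A where "A = Some -` basin e"
  define B where "B = Some -` (\<Union>{V. openin riemann_sphere V \<and> V \<inter> basin e = {}})"
  have "open A" unfolding A_def by (rule open_vimage_Some[OF openin_basin[OF e]])
  moreover have "open B" unfolding B_def by (intro open_vimage_Some openin_Union) auto
  moreover have "\<Gamma> \<subseteq> A \<union> B"
  proof
    fix u assume "u \<in> \<Gamma>"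
    then have u: "Some u \<in> fatou_set C" using \<Gamma> by auto
    show "u \<in> A \<union> B"
      using fatou_closure_basin[OF e u] unfolding A_def B_def by fastforce
  qed
  moreover have "A \<inter> B = {}" by (auto simp: A_def B_def)
  moreover have "z \<in> A \<inter> \<Gamma>" using z by (simp add: A_def)
  moreover have "w \<in> B \<inter> \<Gamma>" using w nw \<open>\<Gamma> \<subseteq> A \<union> B\<close> by (auto simp: A_def)
  ultimately show False using connectedD[OF \<Gamma>(1), of A B] by blast
qed

end

section \<open>The real axis, infinity and the poles\<close>

lemma cheb'_aux_pos:
  fixes x s :: real
  shows "28 * x ^ 4 - 8 * s * x\<^sup>2 + s\<^sup>2 = 28 * (x\<^sup>2 - s / 7)\<^sup>2 + 3 / 7 * s\<^sup>2"
  by (simp add: field_simps power2_eq_square power4_eq_xxxx)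

text \<open>Completing the square in x^2 shows the last factor to be nonnegative for either sign of
  \<open>s\<close>. Hence the real map increases between poles and a monotone orbit cannot overshoot
  a fixed point.\<close>

lemma cheb'_nonneg: "cheb' s a (x::real) \<ge> 0"
  unfolding cheb'_def of_real_eq_id id_apply cheb'_aux_pos
  by (intro divide_nonneg_nonneg mult_nonneg_nonneg add_nonneg_nonneg) auto

lemma cheb_mono:
  fixes x y :: real
  assumes "x \<le> y" "\<And>t. t \<in> {x..y} \<Longrightarrow> quartic' s t \<noteq> 0"
  shows "cheb s a x \<le> cheb s a y"
proof (rule DERIV_nonneg_imp_nondecreasing[OF assms(1)])
  fix t assume "x \<le> t" "t \<le> y"
  then show "\<exists>d. (cheb s a has_real_derivative d) (at t) \<and> 0 \<le> d"
    using has_field_derivative_cheb[OF assms(2)[of t], of a] cheb'_nonneg[of s a t] by auto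
qed

lemma funpow_cheb_of_real: "(cheb s a ^^ n) (of_real x) = of_real ((cheb s a ^^ n) x)"
  by (induction n) (simp_all add: cheb_of_real)

context chebyshev_quartic
begin

lemma None_notin_basin: "None \<notin> basin e"
proof
  assume "None \<in> basin e"
  then have "(\<lambda>n::nat. chordal_dist None (Some e)) \<longlonglongrightarrow> 0"
    unfolding basin_def funpow_C_None mem_Collect_eq .
  then have "chordal_dist None (Some e) = 0" using LIMSEQ_const_iff by blast
  then show False using one_plus_norm_sq_pos[of e] by simp
qed

text \<open>Beyond the largest root the quartic and its first two derivatives are positive, so every
  step goes to the left; monotonicity keeps the orbit from passing 1.\<close>

lemma gt_one_in_basin:
  assumes x: "x > 1"
  shows "Some (of_real x) \<in> basin 1"
proof -
  define f where "f = (cheb (1 + a) a :: real \<Rightarrow> real)"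
  have q': "quartic' (1 + a) y > 0" if "y \<ge> 1" for y :: real
  proof -
    have "y\<^sup>2 \<ge> 1" using that by (rule one_le_power)
    then have "2 * y\<^sup>2 - (1 + a) > 0" using a by linarith
    then have "2 * y * (2 * y\<^sup>2 - (1 + a)) > 0" using that by (intro mult_pos_pos) auto
    moreover have "quartic' (1 + a) y = 2 * y * (2 * y\<^sup>2 - (1 + a))"
      by (simp add: quartic'_def algebra_simps power2_eq_square power3_eq_cube)
    ultimately show ?thesis by simp
  qed
  have f1: "f 1 = 1" using quartic_one[where 'a = real] by (simp add: f_def cheb_def)
  have f: "1 \<le> f y \<and> f y < y" if y: "y \<in> {1<..x}" for y
  proof
    have y1: "y > 1" using y by simp
    have "f 1 \<le> f y" unfolding f_def by (rule cheb_mono) (use y1 q' in \<open>force+\<close>)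
    then show "1 \<le> f y" by (simp add: f1)
    have y2: "y\<^sup>2 > 1" using y1 by (simp add: power2_eq_square less_1_mult)
    then have q: "quartic (1 + a) a y > 0"
    proof -
      have "quartic (1 + a) a y = (y\<^sup>2 - 1) * (y\<^sup>2 - a)"
        by (simp add: quartic_def algebra_simps power2_eq_square power4_eq_xxxx)
      then show ?thesis using y2 a by simp
    qed
    have q'': "quartic'' (1 + a) y > 0" using y2 a by (simp add: quartic''_def)
    have "extraneous (1 + a) a y > 0" unfolding extraneous_def using q q'' by (intro add_nonneg_pos mult_pos_pos) auto
    then show "f y < y" unfolding f_def cheb_def using q q'[of y] y1 by simp
  qed
  have c: "isCont f y" if "y \<in> {1..x}" for y
    unfolding f_def using q'[of y] that by (intro continuous_cheb) auto
  have xin: "x \<in> {1..x}" using x by simp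
  have lim: "(\<lambda>n. (f ^^ n) x) \<longlonglongrightarrow> 1"
    by (rule decreasing_iterates(1)[OF c f f1 xin])
  have ge: "(f ^^ n) x \<in> {1..x}" for n
    by (rule decreasing_iterates(2)[OF c f f1 xin])
  have it: "(c ^^ n) (of_real x) = of_real ((f ^^ n) x)" for n
    unfolding f_def by (rule funpow_cheb_of_real)
  show ?thesis
  proof (rule basinI)
    show "\<not> pole ((c ^^ n) (of_real x))" for n
      unfolding it quartic'_of_real using q'[of "(f ^^ n) x"] ge[of n] by auto
    show "(\<lambda>n. (c ^^ n) (of_real x)) \<longlonglongrightarrow> 1"
      unfolding it using tendsto_of_real[OF lim, where 'a = complex] by simp
  qed
qed

lemma abs_gt_one_in_basin:
  assumes "\<bar>x\<bar> > 1"
  shows "Some (of_real x) \<in> basin 1 \<union> basin (- 1)"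
proof (cases "x > 0")
  case True
  then show ?thesis using assms gt_one_in_basin[of x] by simp
next
  case False
  then show ?thesis using assms gt_one_in_basin[of "- x"] basin_neg[of "Some (of_real (- x))" 1] by simp
qed

text \<open>Infinity is a limit of real points attracted to 1. As a Fatou point it would belong to
  that basin, but it is fixed.\<close>

lemma julia_None: "None \<in> julia_set C"
proof (rule ccontr)
  assume "None \<notin> julia_set C"
  then have F: "None \<in> fatou_set C" by (simp add: julia_set_def)
  have "None \<in> basin 1"
  proof (rule fatou_closure_basin[OF quartic_one F])
    fix V assume "openin riemann_sphere V" "None \<in> V"
    then obtain R where R: "\<And>z. norm z > R \<Longrightarrow> Some z \<in> V"
      by (auto simp: openin_riemann_sphere_iff)
    define x where "x = max 2 (R + 1)"
    have "norm (of_real x :: complex) > R" unfolding x_def norm_of_real by linarith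
    then have "Some (of_real x) \<in> V" by (rule R)
    moreover have "Some (of_real x) \<in> basin 1" by (rule gt_one_in_basin) (simp add: x_def)
    ultimately show "V \<inter> basin 1 \<noteq> {}" by blast
  qed
  then show False using None_notin_basin by blast
qed

lemma pole_real:
  assumes "pole e"
  obtains x where "e = of_real x"
proof -
  have "2 * e * (2 * e\<^sup>2 - of_real (1 + a)) = 0"
    using assms by (simp add: quartic'_def algebra_simps power2_eq_square power3_eq_cube)
  then have e: "e = 0 \<or> 2 * e\<^sup>2 = of_real (1 + a)" by simp
  define t where "t = sqrt ((1 + a) / 2)"
  have t: "(of_real t :: complex)\<^sup>2 = of_real ((1 + a) / 2)"
    using a by (simp add: t_def flip: of_real_power)
  have "e = 0 \<or> e = of_real t \<or> e = - of_real t"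
  proof (cases "e = 0")
    case False
    then have "2 * e\<^sup>2 = 2 * (of_real t)\<^sup>2" using e t by (simp add: field_simps)
    then have "e\<^sup>2 = (of_real t)\<^sup>2" by simp
    then show ?thesis by (simp add: power2_eq_iff)
  qed simp
  then have "e = of_real 0 \<or> e = of_real t \<or> e = of_real (- t)" by simp
  then show ?thesis using that by blast
qed

text \<open>This cannot be deduced from \<open>julia_None\<close> by forward invariance of the Fatou
  set, because \<open>fatou_C\<close> rests on the present fact. Instead, the poles are real, and
  real points near a pole are thrown beyond 1 in absolute value, into the basin of 1 or -1. A pole
  in the Fatou set would lie in one of these basins, though its image infinity does not.\<close>

lemma julia_pole:
  assumes e: "pole e"
  shows "Some e \<in> julia_set C"
proof (rule ccontr)
  assume "Some e \<notin> julia_set C"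
  then have F: "Some e \<in> fatou_set C" by (simp add: julia_set_def)
  obtain x where x: "e = of_real x" using pole_real[OF e] by blast
  have meets: "V \<inter> (basin 1 \<union> basin (- 1)) \<noteq> {}" if V: "openin riemann_sphere V" "Some e \<in> V" for V
  proof -
    define G :: "sphere set" where "G = insert None (Some ` {z. norm z > 1})"
    have "Some -` G = {z. norm z > 1}" by (auto simp: G_def)
    moreover have "open {z::complex. norm z > 1}" by (intro open_Collect_less continuous_intros)
    ultimately have "openin riemann_sphere G"
      unfolding openin_riemann_sphere_iff by (auto simp: G_def)
    then have "openin riemann_sphere {y \<in> topspace riemann_sphere. C y \<in> G}"
      by (rule openin_continuous_map_preimage[OF continuous_C])
    then have "openin riemann_sphere (V \<inter> {y \<in> topspace riemann_sphere. C y \<in> G})"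
      using V by blast
    then have "open (Some -` (V \<inter> {y \<in> topspace riemann_sphere. C y \<in> G}))"
      by (rule open_vimage_Some)
    moreover have "e \<in> Some -` (V \<inter> {y \<in> topspace riemann_sphere. C y \<in> G})"
      using V e by (simp add: C_simps G_def)
    ultimately obtain d where d: "d > 0" "ball e d \<subseteq> Some -` (V \<inter> {y \<in> topspace riemann_sphere. C y \<in> G})"
      using openE by blast
    \<comment> \<open>A real neighbour that is not itself a pole: the interval is infinite and there
      are only finitely many poles.\<close>
    have "infinite {x<..<x + d}" using d(1) by simp
    then have "infinite ((of_real :: real \<Rightarrow> complex) ` {x<..<x + d})"
      by (simp add: finite_image_iff inj_on_def)
    then have "\<not> (of_real :: real \<Rightarrow> complex) ` {x<..<x + d} \<subseteq> {z. pole z}"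
      using finite_poles finite_subset by blast
    then obtain u where u: "u \<in> {x<..<x + d}" "\<not> pole (of_real u)" by blast
    have "dist e (of_real u) < d" using u(1) by (simp add: x dist_of_real dist_real_def)
    then have "Some (of_real u) \<in> V" "C (Some (of_real u)) \<in> G" using d(2) by auto
    then have "norm (c (of_real u)) > 1" using u(2) by (auto simp: C_simps G_def)
    then have "\<bar>cheb (1 + a) a u\<bar> > 1" by (simp add: cheb_of_real)
    then have "C (Some (of_real u)) \<in> basin 1 \<union> basin (- 1)"
      using u(2) abs_gt_one_in_basin by (simp add: C_simps cheb_of_real)
    then have "Some (of_real u) \<in> basin 1 \<union> basin (- 1)" by (simp add: basin_C)
    with \<open>Some (of_real u) \<in> V\<close> show ?thesis by blast
  qed
  have "Some e \<in> basin 1 \<or> Some e \<in> basin (- 1)"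
  proof (rule ccontr)
    assume neg: "\<not> (Some e \<in> basin 1 \<or> Some e \<in> basin (- 1))"
    have q: "quartic (1 + a) a (1::complex) = 0" "quartic (1 + a) a (- 1::complex) = 0"
      using quartic_one[where 'a = complex] by simp_all
    obtain V1 where V1: "openin riemann_sphere V1" "Some e \<in> V1" "V1 \<inter> basin 1 = {}"
      using fatou_closure_basin[OF q(1) F] neg by blast
    obtain V2 where V2: "openin riemann_sphere V2" "Some e \<in> V2" "V2 \<inter> basin (- 1) = {}"
      using fatou_closure_basin[OF q(2) F] neg by blast
    show False using meets[OF openin_Int[OF V1(1) V2(1)]] V1 V2 by blast
  qed
  then have "C (Some e) \<in> basin 1 \<or> C (Some e) \<in> basin (- 1)" by (simp add: basin_C)
  then show False using e None_notin_basin by (simp add: C_simps)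
qed

lemma fatou_cases:
  assumes "x \<in> fatou_set C"
  obtains z where "x = Some z" "\<not> pole z" "C x = Some (c z)"
  using assms julia_None julia_pole by (cases x) (auto simp: julia_set_def C_simps)

lemma fatou_C:
  assumes x: "x \<in> fatou_set C"
  shows "C x \<in> fatou_set C"
proof (rule fatou_forward[OF x])
  fix U assume U: "openin riemann_sphere U" "x \<in> U"
  obtain z where z: "x = Some z" "\<not> pole z" "C x = Some (c z)" using fatou_cases[OF x] by blast
  have "open (Some -` U \<inter> {z. \<not> pole z})" using open_vimage_Some[OF U(1)] open_nonpoles by blast
  moreover have "z \<in> Some -` U \<inter> {z. \<not> pole z}" using z U by simp
  ultimately obtain d where d: "d > 0" "cball z d \<subseteq> Some -` U \<inter> {z. \<not> pole z}"
    using open_contains_cball by (metis (no_types, lifting))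
  have sub: "ball z d \<subseteq> cball z d" by (rule ball_subset_cball)
  have "open (c ` ball z d)" using d sub by (intro open_map_c) blast+
  moreover have "compactin riemann_sphere (Some ` cball z d)" by (intro compactin_Some_image) simp
  moreover have "Some ` c ` ball z d \<subseteq> C ` Some ` cball z d"
  proof
    fix y assume "y \<in> Some ` c ` ball z d"
    then obtain w where w: "w \<in> ball z d" "y = Some (c w)" by auto
    then have wc: "w \<in> cball z d" using sub by blast
    then have "\<not> pole w" using d(2) by blast
    then have "y = C (Some w)" using w by (simp add: C_simps)
    then show "y \<in> C ` Some ` cball z d" using wc by blast
  qed
  moreover have "C x \<in> Some ` c ` ball z d" using z d(1) by simp
  moreover have "Some ` cball z d \<subseteq> U" using d(2) by blast
  ultimately show "\<exists>B V. compactin riemann_sphere B \<and> B \<subseteq> U \<and> openin riemann_sphere V \<and> C x \<in> V \<and> V \<subseteq> C ` B"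
    by (intro exI[of _ "Some ` cball z d"] exI[of _ "Some ` c ` ball z d"]) (simp add: openin_Some_image)
qed

lemma fatou_C_iff: "C x \<in> fatou_set C \<longleftrightarrow> x \<in> fatou_set C"
  using fatou_C fatou_backward[OF continuous_C] by blast

lemma fatou_orbit:
  assumes z: "Some z \<in> fatou_set C"
  shows "(C ^^ n) (Some z) = Some ((c ^^ n) z)" "\<not> pole ((c ^^ n) z)" "Some ((c ^^ n) z) \<in> fatou_set C"
proof -
  have F: "(C ^^ n) (Some z) \<in> fatou_set C" for n
    by (induction n) (auto simp: z fatou_C)
  have "(C ^^ n) (Some z) \<noteq> None" using F[of n] julia_None by (metis ComplD julia_set_def)
  then show *: "(C ^^ n) (Some z) = Some ((c ^^ n) z)" by (rule funpow_C_Some)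
  then show "Some ((c ^^ n) z) \<in> fatou_set C" using F[of n] by simp
  then show "\<not> pole ((c ^^ n) z)" using julia_pole by (auto simp: julia_set_def)
qed

section \<open>Derivatives of the iterates\<close>

lemma has_field_derivative_funpow_c:
  assumes "\<And>k. k < n \<Longrightarrow> \<not> pole ((c ^^ k) z)"
  shows "((c ^^ n) has_field_derivative (\<Prod>k<n. cheb' (1 + a) a ((c ^^ k) z))) (at z)"
  using assms
proof (induction n)
  case (Suc n)
  have "((c \<circ> (c ^^ n)) has_field_derivative
      cheb' (1 + a) a ((c ^^ n) z) * (\<Prod>k<n. cheb' (1 + a) a ((c ^^ k) z))) (at z)"
    using Suc by (intro DERIV_chain has_field_derivative_cheb) auto
  then show ?case by (simp add: mult.commute o_def)
qed (simp add: id_def)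

lemma holomorphic_funpow_c:
  "c ^^ n holomorphic_on (Some -` fatou_set C)"
  unfolding holomorphic_on_open[OF open_vimage_Some[OF openin_fatou_set]]
proof
  fix z assume "z \<in> Some -` fatou_set C"
  then have "Some z \<in> fatou_set C" by simp
  from has_field_derivative_funpow_c[OF fatou_orbit(2)[OF this]]
  show "\<exists>d. ((c ^^ n) has_field_derivative d) (at z)" by blast
qed

text \<open>Along a bounded subsequence of an orbit in the Fatou set the multipliers cannot blow up,
  by normality and Cauchy's estimate.\<close>

lemma fatou_multiplier_bounded:
  assumes z: "Some z \<in> fatou_set C" and N: "\<And>k. N k > 0"
    and M: "\<And>k. norm ((c ^^ N k) z) \<le> M"
    and big: "\<And>k. norm (\<Prod>j<N k. cheb' (1 + a) a ((c ^^ j) z)) \<ge> real k"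
  shows False
proof -
  \<comment> \<open>Points of modulus at most \<open>M\<close> have chordal distance at least 2e
    from infinity. Iterates of nearby points, being within e of those of z, stay at distance more
    than e from infinity, hence below the bound \<open>B\<close> chosen later; Cauchy's estimate on
    a disc of radius d then bounds the derivatives by B / d.\<close>
  define e where "e = 1 / sqrt (1 + M\<^sup>2)"
  have M0: "M \<ge> 0" using M[of 0] norm_ge_zero order_trans by blast
  have pos: "1 + M\<^sup>2 > 0" by (simp add: add_pos_nonneg)
  have e: "e > 0" using pos by (simp add: e_def)
  have "\<exists>r. strict_mono r \<and> (\<forall>e>0. \<exists>V. openin riemann_sphere V \<and> Some z \<in> V \<and>
           (\<forall>\<^sub>F k in sequentially. \<forall>y\<in>V. chordal_dist ((C ^^ N (r k)) (Some z)) ((C ^^ N (r k)) y) < e))"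
    by (rule fatou_equicontinuous[OF continuous_C z N])
  then obtain r where "strict_mono r \<and> (\<forall>e>0. \<exists>V. openin riemann_sphere V \<and> Some z \<in> V \<and>
           (\<forall>\<^sub>F k in sequentially. \<forall>y\<in>V. chordal_dist ((C ^^ N (r k)) (Some z)) ((C ^^ N (r k)) y) < e))"
    by (elim exE)
  then have r: "strict_mono r" and "\<exists>V. openin riemann_sphere V \<and> Some z \<in> V \<and>
           (\<forall>\<^sub>F k in sequentially. \<forall>y\<in>V. chordal_dist ((C ^^ N (r k)) (Some z)) ((C ^^ N (r k)) y) < e)"
    using e by blast+
  then obtain V where "openin riemann_sphere V \<and> Some z \<in> V \<and>
           (\<forall>\<^sub>F k in sequentially. \<forall>y\<in>V. chordal_dist ((C ^^ N (r k)) (Some z)) ((C ^^ N (r k)) y) < e)"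
    by (elim exE)
  then have V: "openin riemann_sphere V" "Some z \<in> V" and
    Ve: "\<forall>\<^sub>F k in sequentially. \<forall>y\<in>V. chordal_dist ((C ^^ N (r k)) (Some z)) ((C ^^ N (r k)) y) < e"
    by blast+
  have oF: "open (Some -` fatou_set C)" by (rule open_vimage_Some[OF openin_fatou_set])
  have "open (Some -` V \<inter> Some -` fatou_set C)"
    using open_vimage_Some[OF V(1)] oF by blast
  moreover have "z \<in> Some -` V \<inter> Some -` fatou_set C" using V z by simp
  ultimately obtain d where d: "d > 0" "cball z d \<subseteq> Some -` V \<inter> Some -` fatou_set C"
    using open_contains_cball by (metis (no_types, lifting))
  define B where "B = 2 * sqrt (1 + M\<^sup>2)"
  obtain k0 where k0: "\<And>k. k \<ge> k0 \<Longrightarrow> \<forall>y\<in>V. chordal_dist ((C ^^ N (r k)) (Some z)) ((C ^^ N (r k)) y) < e"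
    using Ve unfolding eventually_sequentially by blast
  obtain k1 where k1: "real k1 > B / d" using reals_Archimedean2 by blast
  define k where "k = max k0 k1"
  have bound: "norm ((c ^^ N (r k)) w) \<le> B" if w: "w \<in> cball z d" for w
  proof -
    have wV: "Some w \<in> V" "Some w \<in> fatou_set C" using w d(2) by auto
    define u v where "u = (c ^^ N (r k)) z" and "v = (c ^^ N (r k)) w"
    have "chordal_dist ((C ^^ N (r k)) (Some z)) ((C ^^ N (r k)) (Some w)) < e"
      using k0[of k] wV by (simp add: k_def)
    then have 1: "chordal_dist (Some u) (Some v) < e"
      by (simp only: fatou_orbit(1)[OF z] fatou_orbit(1)[OF wV(2)] u_def v_def)
    have "sqrt (1 + (norm u)\<^sup>2) \<le> sqrt (1 + M\<^sup>2)"
      using power_mono[OF M[of "r k"], of 2] by (simp only: u_def real_sqrt_le_iff add_le_cancel_left norm_ge_zero)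
    then have 2: "chordal_dist (Some u) None \<ge> 2 * e"
      using one_plus_norm_sq_pos[of u] pos by (simp add: e_def frac_le)
    have "chordal_dist (Some u) None \<le> chordal_dist (Some u) (Some v) + chordal_dist (Some v) None"
      by (rule chordal_dist_triangle)
    with 1 2 have "chordal_dist (Some v) None > e" by linarith
    then have "sqrt (1 + (norm v)\<^sup>2) < 2 * sqrt (1 + M\<^sup>2)"
      using one_plus_norm_sq_pos[of v] pos by (simp add: e_def field_simps)
    also have "2 * sqrt (1 + M\<^sup>2) = B" by (simp add: B_def)
    finally have "sqrt (1 + (norm v)\<^sup>2) < B" .
    moreover have "norm v \<le> sqrt (1 + (norm v)\<^sup>2)" by (rule real_le_rsqrt) simp
    ultimately show ?thesis by (simp add: v_def)
  qed
  have hol: "c ^^ N (r k) holomorphic_on cball z d"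
    using holomorphic_on_subset[OF holomorphic_funpow_c] d(2) by blast
  have "norm ((deriv ^^ 1) (c ^^ N (r k)) z) \<le> fact 1 * B / d ^ 1"
  proof (rule Cauchy_inequality)
    show "c ^^ N (r k) holomorphic_on ball z d" using hol ball_subset_cball holomorphic_on_subset by blast
    show "continuous_on (cball z d) (c ^^ N (r k))" using hol by (rule holomorphic_on_imp_continuous_on)
    show "norm ((c ^^ N (r k)) x) \<le> B" if "norm (z - x) = d" for x
      using that by (intro bound) (simp add: dist_norm)
  qed (use d in simp)
  moreover have "deriv (c ^^ N (r k)) z = (\<Prod>j<N (r k). cheb' (1 + a) a ((c ^^ j) z))"
    by (rule DERIV_imp_deriv[OF has_field_derivative_funpow_c[OF fatou_orbit(2)[OF z]]])
  ultimately have "norm (\<Prod>j<N (r k). cheb' (1 + a) a ((c ^^ j) z)) \<le> B / d" by simp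
  moreover have "real k1 \<le> real (r k)" using seq_suble[OF r, of k] by (simp add: k_def)
  ultimately show False using big[of "r k"] k1 by linarith
qed

end

section \<open>Dynamics on the imaginary axis\<close>

lemma quartic_imag: "quartic s a (\<i> * of_real y) = of_real (quartic (- s) a y)"
  by (simp add: quartic_def power_mult_distrib)

lemma quartic'_imag: "quartic' s (\<i> * of_real y) = - \<i> * of_real (quartic' (- s) y)"
  by (simp add: quartic'_def power_mult_distrib power3_eq_cube algebra_simps)

lemma quartic''_imag: "quartic'' s (\<i> * of_real y) = - of_real (quartic'' (- s) y)"
  by (simp add: quartic''_def power_mult_distrib)

text \<open>Substituting iy turns z^4 - s z^2 + a into y^4 + s y^2 + a, and Chebyshev's method
  commutes with the linear change of variable. The axis is therefore invariant and carries a real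
  map of the same family.\<close>

lemma cheb_imag: "cheb s a (\<i> * of_real y) = \<i> * of_real (cheb (- s) a y)"
proof -
  have e: "extraneous s a (\<i> * of_real y) = - of_real (extraneous (- s) a y)"
    unfolding extraneous_def quartic_imag quartic'_imag quartic''_imag by (simp add: power_mult_distrib)
  have "(- \<i>) ^ 3 = \<i>" by (simp add: power3_eq_cube)
  then have "(- \<i> * z) ^ 3 = \<i> * z ^ 3" for z :: complex
    by (simp only: power_mult_distrib)
  then have q: "quartic' s (\<i> * of_real y) ^ 3 = \<i> * of_real (quartic' (- s) y ^ 3)"
    unfolding quartic'_imag by simp
  have "- (A * B) / (2 * (\<i> * D)) = \<i> * (A * B / (2 * D))" for A B D :: complex
    by (cases "D = 0") (simp_all add: field_simps)
  then show ?thesis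
    unfolding cheb_def e q quartic_imag by (simp add: right_diff_distrib)
qed

lemma cheb'_imag: "cheb' s a (\<i> * of_real y) = of_real (cheb' (- s) a y)"
proof -
  have "(- \<i> * z) ^ 4 = z ^ 4" for z :: complex
    by (simp add: power_mult_distrib)
  then have q: "quartic' s (\<i> * of_real y) ^ 4 = of_real (quartic' (- s) y ^ 4)"
    unfolding quartic'_imag by simp
  show ?thesis
    unfolding cheb'_def q quartic_imag by (simp add: power_mult_distrib)
qed

lemma funpow_cheb_imag: "(cheb s a ^^ n) (\<i> * of_real y) = \<i> * of_real ((cheb (- s) a ^^ n) y)"
  by (induction n) (simp_all add: cheb_imag)

section \<open>Sign and expansion estimates for the real model of the axis\<close>

lemma quartic'_minus_pos:
  fixes s y :: real
  assumes "s > 0" "y > 0"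
  shows "quartic' (- s) y > 0"
proof -
  have "quartic' (- s) y = 2 * y * (2 * y\<^sup>2 + s)"
    by (simp add: quartic'_def algebra_simps power2_eq_square power3_eq_cube)
  then show ?thesis using assms by (simp add: add_pos_pos)
qed

lemma extraneous_minus:
  fixes y :: real
  shows "extraneous (- s) a y = 44 * (y\<^sup>2) ^ 3 + 46 * s * (y\<^sup>2)\<^sup>2 + (10 * s\<^sup>2 + 12 * a) * y\<^sup>2 + 2 * a * s"
  by (simp add: extraneous_def quartic_def quartic'_def quartic''_def algebra_simps eval_nat_numeral)

text \<open>\<open>extraneous (- s) a y / y\<^sup>2\<close> is increasing in \<open>y > 0\<close> when \<open>a < 0\<close>.\<close>

lemma extraneous_minus_pos_mono:
  fixes x y :: real
  assumes "s > 0" "a < 0" "0 < y" "y \<le> x" "extraneous (- s) a y > 0"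
  shows "extraneous (- s) a x > 0"
proof -
  define v w where "v = y\<^sup>2" and "w = x\<^sup>2"
  have v: "v > 0" "v \<le> w" using assms by (auto simp: v_def w_def power_mono)
  have "extraneous (- s) a x * v - extraneous (- s) a y * w =
      (w - v) * (v * w * (44 * (w + v) + 46 * s) + 2 * s * (- a))"
    unfolding extraneous_minus v_def[symmetric] w_def[symmetric]
    by (simp add: algebra_simps eval_nat_numeral)
  also have "\<dots> \<ge> 0" using v assms by (intro mult_nonneg_nonneg add_nonneg_nonneg) auto
  finally have "extraneous (- s) a x * v \<ge> extraneous (- s) a y * w" by simp
  moreover have "extraneous (- s) a y * w > 0" using assms v by simp
  ultimately have "extraneous (- s) a x * v > 0" by linarith
  then show ?thesis using v(1) by (simp add: zero_less_mult_iff)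
qed

text \<open>The assumption on \<open>extraneous\<close> says that L is at most -2. Squaring it
  bounds \<open>p1 ^ 4\<close> by a quarter of \<open>p\<^sup>2 * p2\<^sup>2\<close>, and
  \<open>16 * X - 3 * p2\<^sup>2\<close> is a perfect square, which replaces
  \<open>p2\<^sup>2\<close> by a multiple of \<open>X\<close>. The estimate in fact yields
  9/2.\<close>

lemma two_le_cheb':
  fixes y :: real
  assumes q': "quartic' s y \<noteq> 0" and E: "extraneous s a y \<le> 0"
  shows "2 \<le> cheb' s a y"
proof -
  define p p1 p2 X where "p = quartic s a y" and "p1 = quartic' s y" and "p2 = quartic'' s y"
    and "X = 28 * y ^ 4 - 8 * s * y\<^sup>2 + s\<^sup>2"
  have "16 * X - 3 * p2\<^sup>2 = 4 * (2 * y\<^sup>2 + s)\<^sup>2"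
    unfolding X_def p2_def quartic''_def by (simp add: algebra_simps power2_eq_square power4_eq_xxxx)
  also have "\<dots> \<ge> 0" by simp
  finally have X: "3 * p2\<^sup>2 \<le> 16 * X" by simp
  have "2 * p1\<^sup>2 \<le> - (p * p2)" using E by (simp add: extraneous_def p_def p1_def p2_def)
  then have "(2 * p1\<^sup>2)\<^sup>2 \<le> (- (p * p2))\<^sup>2" by (intro power_mono) auto
  then have "4 * p1 ^ 4 \<le> p\<^sup>2 * p2\<^sup>2" by (simp add: power_mult_distrib flip: power_mult)
  also have "p\<^sup>2 * p2\<^sup>2 \<le> p\<^sup>2 * (16 / 3 * X)" using X by (intro mult_left_mono) auto
  also have "\<dots> = 16 / 3 * (p\<^sup>2 * X)" by simp
  finally have "4 * p1 ^ 4 \<le> 16 / 3 * (p\<^sup>2 * X)" .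
  moreover have "p1 ^ 4 \<ge> 0" by simp
  ultimately have "2 * p1 ^ 4 \<le> 6 * (p\<^sup>2 * X)" by linarith
  then have "2 * p1 ^ 4 \<le> 6 * p\<^sup>2 * X" by (simp only: mult.assoc)
  then show ?thesis using q' unfolding cheb'_def
    by (simp add: p_def p1_def X_def le_divide_eq zero_less_power_eq)
qed

text \<open>Strict expansion of the metric \<open>\<bar>dy\<bar> / \<bar>y\<bar>\<close>; after clearing denominators both inequalities
  become polynomials in \<open>y\<^sup>2\<close>, \<open>s\<close>, \<open>a\<close> with positive coefficients.\<close>

lemma cheb_log_expansion:
  fixes y s a :: real
  assumes "s > 0" "a > 0" "y > 0"
  shows "\<bar>cheb (- s) a y\<bar> < y * cheb' (- s) a y"
proof -
  define v P A B X where "v = y\<^sup>2" and "P = v\<^sup>2 + s * v + a" and "A = 2 * v + s" and "B = 6 * v + s"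
    and "X = 28 * v\<^sup>2 + 8 * s * v + s\<^sup>2"
  have v: "v > 0" using assms by (simp add: v_def)
  have A: "A > 0" using v assms by (simp add: A_def)
  have q: "quartic (- s) a y = P" "quartic' (- s) y = 2 * y * A" "quartic'' (- s) y = 2 * B"
    by (simp_all add: quartic_def quartic'_def quartic''_def P_def A_def B_def v_def algebra_simps eval_nat_numeral)
  define T where "T = A * P * (4 * v * A\<^sup>2 + P * B)"
  \<comment> \<open>A common denominator of the map and of y times its derivative, so that both
    comparisons become polynomial.\<close>
  define D where "D = 8 * y * v * A ^ 4"
  have D: "D > 0" using v A assms by (simp add: D_def)
  have g: "D * cheb (- s) a y = 8 * v\<^sup>2 * A ^ 4 - T"
    unfolding cheb_def extraneous_def q D_def T_def using A assms(3)
    by (simp add: v_def field_simps) (simp add: algebra_simps eval_nat_numeral)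
  have g': "D * (y * cheb' (- s) a y) = 3 * P\<^sup>2 * X"
    unfolding cheb'_def q D_def using A assms(3)
    by (simp add: v_def X_def field_simps) (simp add: algebra_simps eval_nat_numeral)
  \<comment> \<open>The terms in v^6 cancel: the map is asymptotically linear, so both sides of the
    inequality agree to leading order at infinity. The expansion is strict but can be uniform only
    away from infinity.\<close>
  have "3 * P\<^sup>2 * X + T - 8 * v\<^sup>2 * A ^ 4 =
      4 * s\<^sup>2 * a\<^sup>2 + 32 * v * s * a\<^sup>2 + 12 * v * s^3 * a + 96 * v\<^sup>2 * a\<^sup>2 + 96 * v\<^sup>2 * s\<^sup>2 * a + 304 * v^3 * s * a
      + 4 * v^3 * s^3 + 224 * v^4 * a + 44 * v^4 * s\<^sup>2 + 48 * v^5 * s"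
    unfolding T_def P_def X_def A_def B_def by (simp add: algebra_simps eval_nat_numeral)
  also have "\<dots> > 0" using v assms by (intro add_pos_pos mult_pos_pos zero_less_power) auto
  finally have 1: "D * cheb (- s) a y < D * (y * cheb' (- s) a y)" unfolding g g' by simp
  have "3 * P\<^sup>2 * X - T + 8 * v\<^sup>2 * A ^ 4 =
      2 * s\<^sup>2 * a\<^sup>2 + 16 * v * s * a\<^sup>2 + 72 * v\<^sup>2 * a\<^sup>2 + 12 * v\<^sup>2 * s\<^sup>2 * a + 6 * v\<^sup>2 * s^4 + 128 * v^3 * s * a
      + 56 * v^3 * s^3 + 112 * v^4 * a + 226 * v^4 * s\<^sup>2 + 336 * v^5 * s + 168 * v^6"
    unfolding T_def P_def X_def A_def B_def by (simp add: algebra_simps eval_nat_numeral)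
  also have "\<dots> > 0" using v assms by (intro add_pos_pos mult_pos_pos zero_less_power) auto
  finally have 2: "- (D * cheb (- s) a y) < D * (y * cheb' (- s) a y)" unfolding g g' by simp
  have "D * (- cheb (- s) a y) < D * (y * cheb' (- s) a y)" using 2 by simp
  then have "- cheb (- s) a y < y * cheb' (- s) a y" using D by (simp only: mult_less_cancel_left_pos)
  moreover have "cheb (- s) a y < y * cheb' (- s) a y" using 1 D by (simp only: mult_less_cancel_left_pos)
  ultimately show ?thesis by (simp add: abs_less_iff)
qed

context chebyshev_quartic
begin

abbreviation g :: "real \<Rightarrow> real" where "g \<equiv> cheb (- (1 + a)) a"
abbreviation g' :: "real \<Rightarrow> real" where "g' \<equiv> cheb' (- (1 + a)) a"

lemma s_pos: "1 + a > 0" using a by simp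

lemma pole_imag: "pole (\<i> * of_real y) \<longleftrightarrow> y = 0"
proof -
  have "quartic' (- (1 + a)) y = 0 \<longleftrightarrow> y = 0"
    using quartic'_minus_pos[OF s_pos, of y] quartic'_minus_pos[OF s_pos, of "- y"]
    by (cases y "0::real" rule: linorder_cases) (auto simp: quartic'_def)
  then show ?thesis unfolding quartic'_imag by simp
qed

lemma fatou_imag_orbit:
  assumes "Some (\<i> * of_real y) \<in> fatou_set C"
  shows "(g ^^ n) y \<noteq> 0"
  using fatou_orbit(2)[OF assms, of n] unfolding funpow_cheb_imag pole_imag .

lemma fatou_imag_multiplier_bounded:
  assumes y: "Some (\<i> * of_real y) \<in> fatou_set C" and N: "\<And>k. N k > 0"
    and M: "\<And>k. \<bar>(g ^^ N k) y\<bar> \<le> M"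
    and big: "\<And>k. \<bar>\<Prod>j<N k. g' ((g ^^ j) y)\<bar> \<ge> real k"
  shows False
proof (rule fatou_multiplier_bounded[OF y N])
  show "norm ((c ^^ N k) (\<i> * of_real y)) \<le> M" for k
    using M[of k] unfolding funpow_cheb_imag by (simp add: norm_mult)
  have "(\<Prod>j<N k. cheb' (1 + a) a ((c ^^ j) (\<i> * of_real y))) = of_real (\<Prod>j<N k. g' ((g ^^ j) y))" for k
    unfolding funpow_cheb_imag cheb'_imag by simp
  then show "norm (\<Prod>j<N k. cheb' (1 + a) a ((c ^^ j) (\<i> * of_real y))) \<ge> real k" for k
    using big[of k] by (simp only: norm_of_real)
qed

text \<open>The sign of a step is opposite to that of quartic times \<open>extraneous\<close>. Above
  the root \<open>extraneous\<close> is positive because the quartic and its second derivative are;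
  below it, positivity at y persists up to the root by \<open>extraneous_minus_pos_mono\<close>. So
  the orbit moves monotonically towards the root from either side.\<close>

lemma imag_basin:
  assumes "a < 0" "y > 0" and E: "extraneous (- (1 + a)) a y > 0"
  shows "Some (\<i> * of_real y) \<in> basin (\<i> * of_real (sqrt (- a)))"
proof -
  define b where "b = sqrt (- a)"
  have b: "b > 0" "b\<^sup>2 = - a" using assms by (auto simp: b_def)
  have q: "quartic (- (1 + a)) a t = (t\<^sup>2 + 1) * (t\<^sup>2 - b\<^sup>2)" for t :: real
    unfolding b(2) by (simp add: quartic_def algebra_simps power2_eq_square power4_eq_xxxx)
  have q': "quartic' (- (1 + a)) t > 0" if "t > 0" for t :: real
    by (rule quartic'_minus_pos[OF s_pos that])
  have "quartic (- (1 + a)) a b = 0" unfolding q by simp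
  then have gb: "g b = b" by (simp add: cheb_def)
  have cont: "isCont g t" if "t > 0" for t
    using q'[OF that] by (intro continuous_cheb) auto
  have mono: "g t \<le> g u" if "0 < t" "t \<le> u" for t u
    by (rule cheb_mono[OF that(2)]) (use q' that in \<open>force simp: less_imp_neq[symmetric]\<close>)
  have step: "g t = t - quartic (- (1 + a)) a t * extraneous (- (1 + a)) a t / (2 * quartic' (- (1 + a)) t ^ 3)" for t
    by (simp add: cheb_def)
  have lim: "(\<lambda>n. (g ^^ n) y) \<longlonglongrightarrow> b \<and> (\<forall>n. (g ^^ n) y > 0)"
  proof (cases "b \<le> y")
    case True
    have g: "b \<le> g t \<and> g t < t" if t: "t \<in> {b<..y}" for t
    proof
      have t0: "t > b" "t > 0" using t b by auto
      show "b \<le> g t" using mono[of b t] gb t0 b by simp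
      have sq: "t\<^sup>2 > b\<^sup>2" using t0 b by (intro power_strict_mono) auto
      have qt: "quartic (- (1 + a)) a t > 0"
        unfolding q using sq by (intro mult_pos_pos) (auto simp: add_nonneg_pos)
      have "quartic'' (- (1 + a)) t = 12 * t\<^sup>2 + 2 * (1 + a)" by (simp add: quartic''_def)
      also have "\<dots> > 0" by (rule add_nonneg_pos) (use s_pos in simp_all)
      finally have q'': "quartic'' (- (1 + a)) t > 0" .
      have "extraneous (- (1 + a)) a t > 0"
        unfolding extraneous_def by (intro add_nonneg_pos mult_pos_pos qt q'') simp
      then have "quartic (- (1 + a)) a t * extraneous (- (1 + a)) a t / (2 * quartic' (- (1 + a)) t ^ 3) > 0"
        using qt q'[OF t0(2)] by (intro divide_pos_pos mult_pos_pos) auto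
      then show "g t < t" unfolding step by linarith
    qed
    have ct: "isCont g t" if "t \<in> {b..y}" for t using that b by (intro cont) auto
    have yin: "y \<in> {b..y}" using True by simp
    have "(\<lambda>n. (g ^^ n) y) \<longlonglongrightarrow> b"
      by (rule decreasing_iterates(1)[OF ct g gb yin])
    moreover have "(g ^^ n) y > 0" for n
      using decreasing_iterates(2)[OF ct g gb yin, where n = n] b(1) by simp
    ultimately show ?thesis by simp
  next
    case False
    have g: "g t \<le> b \<and> t < g t" if t: "t \<in> {y..<b}" for t
    proof
      have t0: "t < b" "t > 0" using t assms by auto
      show "g t \<le> b" using mono[of t b] gb t0 b by simp
      have sq: "t\<^sup>2 < b\<^sup>2" using t0 b by (intro power_strict_mono) auto
      have qt: "quartic (- (1 + a)) a t < 0"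
        unfolding q using sq by (intro mult_pos_neg) (auto simp: add_nonneg_pos)
      have "extraneous (- (1 + a)) a t > 0"
        using extraneous_minus_pos_mono[OF s_pos assms(1,2) _ E, of t] t by simp
      then have "quartic (- (1 + a)) a t * extraneous (- (1 + a)) a t / (2 * quartic' (- (1 + a)) t ^ 3) < 0"
        using qt q'[OF t0(2)] by (intro divide_neg_pos mult_neg_pos) auto
      then show "t < g t" unfolding step by linarith
    qed
    have ct: "isCont g t" if "t \<in> {y..b}" for t using that assms by (intro cont) auto
    have yin: "y \<in> {y..b}" using False by simp
    have "(\<lambda>n. (g ^^ n) y) \<longlonglongrightarrow> b"
      by (rule increasing_iterates(1)[OF ct g gb yin])
    moreover have "(g ^^ n) y > 0" for n
      using increasing_iterates(2)[OF ct g gb yin, where n = n] assms(2) by simp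
    ultimately show ?thesis by simp
  qed
  show ?thesis unfolding b_def[symmetric]
  proof (rule basinI)
    show "\<not> pole ((c ^^ n) (\<i> * of_real y))" for n
      unfolding funpow_cheb_imag pole_imag using lim by (metis less_irrefl)
    show "(\<lambda>n. (c ^^ n) (\<i> * of_real y)) \<longlonglongrightarrow> \<i> * of_real b"
      unfolding funpow_cheb_imag using lim by (intro tendsto_intros) auto
  qed
qed

text \<open>If \<open>extraneous\<close> is positive somewhere on the orbit,
  \<open>imag_basin\<close> applies, up to a sign. Otherwise the derivative is at least 2 at every
  step, while the orbit stays in [-1, 1] because \<open>extraneous\<close> is positive outside; the
  multipliers then blow up along a bounded orbit, which a Fatou point forbids.\<close>

lemma fatou_imag_basin:
  assumes a0: "a < 0" and y: "Some (\<i> * of_real y) \<in> fatou_set C"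
  shows "Some (\<i> * of_real y) \<in> basin (\<i> * of_real (sqrt (- a))) \<union> basin (- (\<i> * of_real (sqrt (- a))))"
proof (cases "\<exists>n. extraneous (- (1 + a)) a ((g ^^ n) y) > 0")
  case True
  then obtain n where n: "extraneous (- (1 + a)) a ((g ^^ n) y) > 0" by blast
  define u where "u = (g ^^ n) y"
  have "u \<noteq> 0" unfolding u_def by (rule fatou_imag_orbit[OF y])
  have "Some (\<i> * of_real u) \<in> basin (\<i> * of_real (sqrt (- a))) \<union> basin (- (\<i> * of_real (sqrt (- a))))"
  proof (cases "u > 0")
    case True
    then show ?thesis using imag_basin[OF a0, of u] n by (simp add: u_def)
  next
    case False
    then have "- u > 0" using \<open>u \<noteq> 0\<close> by simp
    then have "Some (\<i> * of_real (- u)) \<in> basin (\<i> * of_real (sqrt (- a)))"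
      using n by (intro imag_basin[OF a0]) (simp_all add: u_def)
    from basin_neg[OF this] show ?thesis by simp
  qed
  moreover have "(C ^^ n) (Some (\<i> * of_real y)) = Some (\<i> * of_real u)"
    unfolding fatou_orbit(1)[OF y] funpow_cheb_imag u_def ..
  ultimately show ?thesis using basin_funpow[of n "Some (\<i> * of_real y)"] by (metis Un_iff)
next
  case False
  then have E: "extraneous (- (1 + a)) a ((g ^^ n) y) \<le> 0" for n by (simp add: not_less)
  have two: "2 \<le> g' ((g ^^ n) y)" for n
  proof (rule two_le_cheb'[OF _ E])
    show "quartic' (- (1 + a)) ((g ^^ n) y) \<noteq> 0"
      using fatou_imag_orbit[OF y, of n] pole_imag[of "(g ^^ n) y"] unfolding quartic'_imag by simp
  qed
  have prod: "2 ^ n \<le> (\<Prod>j<n. g' ((g ^^ j) y))" for n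
  proof -
    have "(\<Prod>j<n. 2) \<le> (\<Prod>j<n. g' ((g ^^ j) y))" by (rule prod_mono) (use two in auto)
    then show ?thesis by simp
  qed
  have bound: "\<bar>(g ^^ n) y\<bar> \<le> 1" for n
  proof (rule ccontr)
    assume "\<not> \<bar>(g ^^ n) y\<bar> \<le> 1"
    define t where "t = (g ^^ n) y"
    have t: "t\<^sup>2 > 1" using \<open>\<not> \<bar>(g ^^ n) y\<bar> \<le> 1\<close> by (simp add: t_def abs_le_square_iff power2_eq_square) (metis abs_1 abs_le_square_iff not_le one_power2 power2_eq_square)
    have "quartic (- (1 + a)) a t = (t\<^sup>2 + 1) * (t\<^sup>2 + a)"
      by (simp add: quartic_def algebra_simps power2_eq_square power4_eq_xxxx)
    then have "quartic (- (1 + a)) a t > 0" using t a by (simp add: zero_less_mult_iff)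
    moreover have "quartic'' (- (1 + a)) t > 0" using t a by (simp add: quartic''_def)
    ultimately have "extraneous (- (1 + a)) a t > 0" unfolding extraneous_def by (intro add_nonneg_pos mult_pos_pos) auto
    then show False using E[of n] by (simp add: t_def)
  qed
  have False
  proof (rule fatou_imag_multiplier_bounded[OF y, of Suc])
    show "\<bar>(g ^^ Suc k) y\<bar> \<le> 1" for k by (rule bound)
    show "real k \<le> \<bar>\<Prod>j<Suc k. g' ((g ^^ j) y)\<bar>" for k
    proof -
      have "real k \<le> 2 ^ Suc k" using of_nat_less_two_power[of "Suc k", where 'a = real] by simp
      also have "\<dots> \<le> (\<Prod>j<Suc k. g' ((g ^^ j) y))" by (rule prod)
      finally show ?thesis by linarith
    qed
  qed simp
  then show ?thesis ..
qed

text \<open>For \<open>a > 0\<close>, an orbit on the imaginary axis returns infinitely often to a compact set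
  \<open>r \<le> \<bar>y\<bar> \<le> R\<close>, on which the expansion in the metric \<open>\<bar>dy\<bar> / \<bar>y\<bar>\<close> is uniform.\<close>

lemma imag_axis_julia:
  assumes a0: "a > 0"
  shows "Some (\<i> * of_real y) \<in> julia_set C"
proof (rule ccontr)
  assume "Some (\<i> * of_real y) \<notin> julia_set C"
  then have F: "Some (\<i> * of_real y) \<in> fatou_set C" by (simp add: julia_set_def)
  define Y where "Y = (\<lambda>n. (g ^^ n) y)"
  have Y0: "Y n \<noteq> 0" for n unfolding Y_def by (rule fatou_imag_orbit[OF F])
  have YS: "Y (Suc n) = g (Y n)" for n by (simp add: Y_def)
  obtain R where R: "R > 0" "\<And>t::real. norm t \<ge> R \<Longrightarrow> norm (g t) \<ge> norm t / 2 \<and> norm (g t) \<le> 3/4 * norm t"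
    by (rule cheb_near_infinity[where 'a = real]) (rule that)
  have "pole 0" by (simp add: quartic'_def)
  then have "filterlim (\<lambda>w. norm (c w)) at_top (at 0)"
    using filterlim_c_pole filterlim_at_infinity_imp_norm_at_top by blast
  then have "eventually (\<lambda>w. norm (c w) > R) (at 0)" by (simp add: filterlim_at_top_dense)
  then obtain r0 where r0: "r0 > 0" "\<And>w. w \<noteq> 0 \<Longrightarrow> norm w < r0 \<Longrightarrow> norm (c w) > R"
    unfolding eventually_at by auto
  \<comment> \<open>Points within r of the pole 0 are sent beyond R. As r is at most R/2 and a step
    beyond R shrinks by at most a factor 2, an orbit coming back from there lands in the compact
    range instead of jumping over it.\<close>
  define r where "r = min r0 (R / 2)"
  have r: "r > 0" "r \<le> R / 2" using r0 R by (auto simp: r_def)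
  have small: "\<bar>g t\<bar> > R" if "t \<noteq> 0" "\<bar>t\<bar> < r" for t
    using r0(2)[of "\<i> * of_real t"] that unfolding cheb_imag by (simp add: norm_mult r_def)
  define S where "S = {n. r \<le> \<bar>Y n\<bar> \<and> \<bar>Y n\<bar> \<le> R}"
  have big_visit: "\<exists>m\<ge>n. m \<in> S" if "\<bar>Y n\<bar> > R" for n
  proof (rule ccontr)
    assume no: "\<not> (\<exists>m\<ge>n. m \<in> S)"
    have *: "\<bar>Y (n + j)\<bar> > R \<and> \<bar>Y (n + j)\<bar> \<le> (3/4) ^ j * \<bar>Y n\<bar>" for j
    proof (induction j)
      case (Suc j)
      then have b: "\<bar>Y (n + Suc j)\<bar> \<ge> \<bar>Y (n + j)\<bar> / 2" "\<bar>Y (n + Suc j)\<bar> \<le> 3/4 * \<bar>Y (n + j)\<bar>"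
        using R(2)[of "Y (n + j)"] by (auto simp: YS)
      have "n + Suc j \<notin> S" using no by (metis le_add1)
      moreover have "r \<le> \<bar>Y (n + Suc j)\<bar>" using b(1) Suc r by linarith
      ultimately have "\<bar>Y (n + Suc j)\<bar> > R" by (simp add: S_def)
      moreover have "\<bar>Y (n + Suc j)\<bar> \<le> (3/4) ^ Suc j * \<bar>Y n\<bar>" using b(2) Suc by simp
      ultimately show ?case by blast
    qed (use that in simp)
    have "(\<lambda>j. (3/4) ^ j * \<bar>Y n\<bar>) \<longlonglongrightarrow> 0 * \<bar>Y n\<bar>"
      by (intro tendsto_intros LIMSEQ_power_zero) simp
    then have "eventually (\<lambda>j. (3/4) ^ j * \<bar>Y n\<bar> < R) sequentially"
      using R(1) by (auto dest: order_tendstoD)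
    then obtain j where "(3/4) ^ j * \<bar>Y n\<bar> < R" using eventually_happens'[OF sequentially_bot] by blast
    then show False using *[of j] by linarith
  qed
  have visit: "\<exists>m\<ge>n. m \<in> S" for n
  proof -
    consider "n \<in> S" | "\<bar>Y n\<bar> > R" | "\<bar>Y n\<bar> < r" by (force simp: S_def)
    then show ?thesis
    proof cases
      case 3
      then have "\<bar>Y (Suc n)\<bar> > R" using small Y0 by (simp add: YS)
      then show ?thesis using big_visit[of "Suc n"] by (meson Suc_leD)
    qed (use big_visit in auto)
  qed
  have expand: "\<bar>g t\<bar> < \<bar>t\<bar> * g' t" if "t \<noteq> 0" for t
    using cheb_log_expansion[OF s_pos a0, of t] cheb_log_expansion[OF s_pos a0, of "- t"] that
    by (cases "t > 0") auto
  \<comment> \<open>The reciprocal of the expansion factor at t > 0 in the metric |dy| /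
    |y|.\<close>
  define \<kappa> where "\<kappa> = (\<lambda>t. \<bar>g t\<bar> / (t * g' t))"
  have q': "quartic' (- (1 + a)) t > 0" if "t > 0" for t :: real
    by (rule quartic'_minus_pos[OF s_pos that])
  have g'pos: "g' t > 0" if "t \<noteq> 0" for t
  proof -
    have "0 < \<bar>t\<bar> * g' t" using expand[OF that] abs_ge_zero le_less_trans by blast
    then show ?thesis by (simp add: zero_less_mult_iff)
  qed
  have "continuous_on {r..R} \<kappa>"
  proof -
    have "continuous_on {r..R} g"
    proof (intro continuous_at_imp_continuous_on ballI continuous_cheb)
      fix t assume "t \<in> {r..R}"
      then show "quartic' (- (1 + a)) t \<noteq> 0" using q'[of t] r(1) by auto
    qed
    moreover have "\<forall>t\<in>{r..R}. quartic' (- (1 + a)) t ^ 4 \<noteq> 0"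
    proof
      fix t assume "t \<in> {r..R}"
      then show "quartic' (- (1 + a)) t ^ 4 \<noteq> 0" using q'[of t] r(1) by auto
    qed
    then have "continuous_on {r..R} g'"
      unfolding cheb'_def by (intro continuous_intros)
    moreover have "t * g' t \<noteq> 0" if "t \<in> {r..R}" for t
      using g'pos[of t] that r by auto
    ultimately show ?thesis unfolding \<kappa>_def by (intro continuous_intros) auto
  qed
  then obtain t0 where t0: "t0 \<in> {r..R}" "\<And>t. t \<in> {r..R} \<Longrightarrow> \<kappa> t \<le> \<kappa> t0"
    using continuous_attains_sup[of "{r..R}" \<kappa>] r R by auto
  \<comment> \<open>The maximum of \<kappa> may vanish, namely if g does; the 1/2 keeps \<theta>
    positive.\<close>
  define \<theta> where "\<theta> = max (1/2) (\<kappa> t0)"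
  have "\<kappa> t0 < 1"
    using expand[of t0] g'pos[of t0] t0(1) r by (simp add: \<kappa>_def divide_less_eq)
  then have \<theta>: "0 < \<theta>" "\<theta> < 1" by (auto simp: \<theta>_def)
  have uniform: "\<bar>g t\<bar> \<le> \<theta> * (\<bar>t\<bar> * g' t)" if "r \<le> \<bar>t\<bar>" "\<bar>t\<bar> \<le> R" for t
  proof -
    define u where "u = \<bar>t\<bar>"
    have u: "u \<in> {r..R}" "u > 0" using that r by (auto simp: u_def)
    have "\<bar>g t\<bar> = \<bar>g u\<bar>" "g' t = g' u" by (simp_all add: u_def abs_if)
    moreover have "\<kappa> u \<le> \<theta>" using t0(2)[OF u(1)] by (simp add: \<theta>_def)
    ultimately show ?thesis using u g'pos[of u]
      by (simp add: \<kappa>_def divide_le_eq flip: u_def)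
  qed
  define D where "D = (\<lambda>n. \<Prod>j<n. g' (Y j))"
  have D: "D n > 0" for n unfolding D_def using g'pos Y0 by (intro prod_pos) auto
  \<comment> \<open>Up to the constant |y|, this is the reciprocal of the derivative of the n-th
    iterate in the metric |dy| / |y|. It never grows and shrinks by \<theta> at each visit to
    \<open>S\<close>. At a visit |Y n| is at least r, so small \<open>Q n\<close> forces large
    \<open>D n\<close>, the ordinary multiplier.\<close>
  define Q where "Q = (\<lambda>n. \<bar>Y n\<bar> / D n)"
  have Qpos: "Q n > 0" for n using Y0 D by (simp add: Q_def)
  have DS: "D (Suc n) = D n * g' (Y n)" for n by (simp add: D_def)
  have Qmono: "Q (Suc n) \<le> Q n" for n
    using expand[OF Y0[of n]] D[of n] g'pos[OF Y0[of n]] by (simp add: Q_def DS YS field_simps)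
  have Qtheta: "Q (Suc n) \<le> \<theta> * Q n" if "n \<in> S" for n
    using uniform[of "Y n"] that D[of n] g'pos[OF Y0[of n]] by (simp add: S_def Q_def DS YS field_simps)
  have Qdec: "Q m \<le> Q n" if "n \<le> m" for n m
    using lift_Suc_antimono_le[of Q, OF Qmono that] .
  have Qpow: "\<exists>n\<in>S. n > 0 \<and> Q n \<le> \<theta> ^ m * Q 0" for m
  proof (induction m)
    case 0
    obtain n where "n \<ge> 1" "n \<in> S" using visit by blast
    then show ?case using Qdec[of 0 n] by (intro bexI[of _ n]) auto
  next
    case (Suc m)
    then obtain n where n: "n \<in> S" "Q n \<le> \<theta> ^ m * Q 0" by blast
    obtain n' where n': "n' \<ge> Suc n" "n' \<in> S" using visit by blast
    have "Q n' \<le> Q (Suc n)" by (rule Qdec[OF n'(1)])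
    also have "\<dots> \<le> \<theta> * Q n" by (rule Qtheta[OF n(1)])
    also have "\<dots> \<le> \<theta> * (\<theta> ^ m * Q 0)" using n(2) \<theta> by (intro mult_left_mono) auto
    finally show ?case using n' by (intro bexI[of _ n']) auto
  qed
  have "\<exists>n>0. \<bar>Y n\<bar> \<le> R \<and> real k \<le> D n" for k
  proof -
    have "(\<lambda>m. \<theta> ^ m * (Q 0 * real k)) \<longlonglongrightarrow> 0 * (Q 0 * real k)"
      using \<theta> by (intro tendsto_intros LIMSEQ_power_zero) auto
    then have "eventually (\<lambda>m. \<theta> ^ m * (Q 0 * real k) < r) sequentially"
      using r(1) by (auto dest: order_tendstoD)
    then obtain m where m: "\<theta> ^ m * (Q 0 * real k) < r" using eventually_happens'[OF sequentially_bot] by blast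
    obtain n where n: "n \<in> S" "n > 0" "Q n \<le> \<theta> ^ m * Q 0" using Qpow by blast
    have "Q n * real k \<le> \<theta> ^ m * Q 0 * real k" using n(3) by (intro mult_right_mono) auto
    also have "\<dots> < r" using m by (simp add: mult.assoc)
    also have "r \<le> \<bar>Y n\<bar>" using n(1) by (simp add: S_def)
    also have "\<bar>Y n\<bar> = Q n * D n" using D[of n] by (simp add: Q_def)
    finally have "real k < D n" using Qpos[of n] by (simp add: mult_less_cancel_left_pos)
    then show ?thesis using n by (intro exI[of _ n]) (auto simp: S_def)
  qed
  then obtain N where N: "\<And>k. N k > 0" "\<And>k. \<bar>Y (N k)\<bar> \<le> R" "\<And>k. real k \<le> D (N k)" by metis
  show False
  proof (rule fatou_imag_multiplier_bounded[OF F N(1)])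
    show "\<bar>(g ^^ N k) y\<bar> \<le> R" for k using N(2)[of k] by (simp add: Y_def)
    show "real k \<le> \<bar>\<Prod>j<N k. g' ((g ^^ j) y)\<bar>" for k using N(3)[of k] by (simp add: D_def Y_def)
  qed
qed

end

section \<open>A symmetric separating continuum\<close>

lemma closure_uminus:
  fixes S :: "complex set"
  assumes "\<And>z. z \<in> S \<Longrightarrow> - z \<in> S" "z \<in> closure S"
  shows "- z \<in> closure S"
  unfolding closure_approachable
proof (intro allI impI)
  fix e :: real assume "e > 0"
  then obtain y where "y \<in> S" "dist y z < e" using assms(2) unfolding closure_approachable by blast
  then show "\<exists>y\<in>S. dist y (- z) < e"
    using assms(1) by (intro bexI[of _ "- y"]) (auto simp: dist_norm norm_minus_commute)
qed

lemma outside_uminus: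
  fixes S :: "complex set"
  assumes S: "\<And>z. z \<in> S \<Longrightarrow> - z \<in> S" and z: "z \<in> outside S"
  shows "- z \<in> outside S"
proof -
  define W where "W = connected_component_set (- S) z"
  have zS: "z \<notin> S" and unb: "\<not> bounded W" using z by (auto simp: outside_def W_def)
  have zW: "z \<in> W" using zS by (simp add: W_def)
  have "connected (uminus ` W)"
    unfolding W_def by (intro connected_continuous_image continuous_intros connected_connected_component)
  moreover have "W \<subseteq> - S" unfolding W_def by (rule connected_component_subset)
  then have "uminus ` W \<subseteq> - S" using S by fastforce
  moreover have "- z \<in> uminus ` W" using zW by simp
  ultimately have "uminus ` W \<subseteq> connected_component_set (- S) (- z)"
    by (intro connected_component_maximal)
  then have "\<not> bounded (connected_component_set (- S) (- z))"
    using unb bounded_subset bounded_uminus by blast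
  then show ?thesis by (simp add: outside)
qed

text \<open>The set \<Gamma> is the outer boundary of a symmetric connected neighbourhood of 0. It
  is connected, being the frontier of a complementary component of a connected set; it inherits the
  symmetry; and it meets the imaginary axis, which joins 0 to the unbounded side.\<close>

lemma symmetric_separator:
  fixes K L :: "complex set"
  assumes K: "compact K" "\<And>z. z \<in> K \<Longrightarrow> - z \<in> K" "0 \<in> K" and L: "closed L" and KL: "K \<inter> L = {}"
  obtains \<Gamma> y where "connected \<Gamma>" "\<Gamma> \<inter> (K \<union> L) = {}" "\<i> * of_real y \<in> \<Gamma>" "- (\<i> * of_real y) \<in> \<Gamma>"
proof -
  obtain d where d: "d > 0" "\<And>x y. x \<in> K \<Longrightarrow> y \<in> L \<Longrightarrow> d \<le> dist x y"
    using separate_compact_closed[OF K(1) L KL] by blast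
  \<comment> \<open>With half the distance from K to L as radius, the frontier of the neighbourhood
    avoids both sets.\<close>
  define U where "U = (\<Union>k\<in>K. ball k (d/2))"
  have U: "open U" unfolding U_def by blast
  have KU: "K \<subseteq> U" using d(1) by (auto simp: U_def)
  have Usym: "- z \<in> U" if zU: "z \<in> U" for z
  proof -
    obtain k where "k \<in> K" "dist k z < d/2" using zU by (auto simp: U_def)
    then have "- k \<in> K" "- z \<in> ball (- k) (d/2)" using K(2) by (auto simp: dist_norm norm_minus_commute)
    then show ?thesis unfolding U_def by blast
  qed
  have Ubd: "bounded U"
  proof -
    obtain B where B: "\<And>k. k \<in> K \<Longrightarrow> norm k \<le> B" using compact_imp_bounded[OF K(1)] bounded_iff by blast
    have "norm z \<le> B + d/2" if zU: "z \<in> U" for z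
    proof -
      obtain k where k: "k \<in> K" "dist k z < d/2" using zU by (auto simp: U_def)
      then show ?thesis using B[OF k(1)] norm_triangle_ineq2[of z k] by (simp add: dist_norm norm_minus_commute)
    qed
    then show ?thesis unfolding bounded_iff by blast
  qed
  have frU: "frontier U \<inter> (K \<union> L) = {}"
  proof -
    have "z \<notin> L" if zU: "z \<in> frontier U" for z
    proof
      assume zL: "z \<in> L"
      have "z \<in> closure U" using zU by (simp add: frontier_def)
      then obtain u where u: "u \<in> U" "dist u z < d/2"
        using d(1) unfolding closure_approachable by (meson half_gt_zero)
      obtain k where k: "k \<in> K" "dist k u < d/2" using u(1) by (auto simp: U_def)
      have "dist k z \<le> dist k u + dist u z" by (rule dist_triangle)
      then show False using d(2)[OF k(1) zL] k u by linarith
    qed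
    moreover have "frontier U \<inter> U = {}" using U by (auto simp: frontier_def interior_open)
    ultimately show ?thesis using KU by blast
  qed
  define V where "V = connected_component_set U 0"
  have V: "open V" "connected V" "V \<subseteq> U" "0 \<in> V"
    using U KU K(3) by (auto simp: V_def open_connected_component connected_component_subset)
  have Vsym: "- z \<in> V" if zV: "z \<in> V" for z
  proof -
    have "connected (uminus ` V)" using V(2) by (intro connected_continuous_image continuous_intros)
    moreover have "uminus ` V \<subseteq> U" using V(3) Usym by blast
    moreover have "0 \<in> uminus ` V" using V(4) by force
    ultimately have "uminus ` V \<subseteq> V" unfolding V_def by (intro connected_component_maximal)
    then show ?thesis using zV by blast
  qed
  define S where "S = closure V"
  have S: "closed S" "connected S" "bounded S" "V \<subseteq> S"
    using V Ubd bounded_subset by (auto simp: S_def connected_imp_connected_closure closure_subset intro!: bounded_closure)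
  have Ssym: "- z \<in> S" if "z \<in> S" for z
    using closure_uminus[OF Vsym] that by (simp add: S_def)
  \<comment> \<open>Passing from V to the unbounded complementary component of its closure fills the
    holes: the frontier of V itself may be disconnected.\<close>
  define W where "W = outside S"
  have Wo: "open W" unfolding W_def by (rule open_outside[OF S(1)])
  have WS: "W \<inter> S = {}" by (simp add: W_def)
  have "W \<in> components (- S)"
    unfolding W_def outside_in_components
    using connected_outside[OF S(3)] outside_bounded_nonempty[OF S(3)] by simp
  then have conn: "connected (frontier W)"
    by (rule connected_frontier_component_complement[OF S(2)])
  have frW: "frontier W \<subseteq> S" unfolding W_def by (rule frontier_outside_subset[OF S(1)])
  have "V \<inter> closure W = {}"
    using WS S(4) V(1) by (metis Int_commute disjoint_eq_subset_Compl open_Int_closure_eq_empty inf.absorb_iff2 inf_assoc inf_bot_left)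
  then have frWV: "frontier W \<inter> V = {}" by (auto simp: frontier_def)
  have "frontier W \<subseteq> frontier V"
    using frW frWV V(1) by (auto simp: S_def frontier_def interior_open)
  also have "\<dots> \<subseteq> frontier U" unfolding V_def by (rule frontier_of_connected_component_subset)
  finally have dis: "frontier W \<inter> (K \<union> L) = {}" using frU by blast
  define T where "T = (\<lambda>t. \<i> * complex_of_real t) ` UNIV"
  have "connected T" unfolding T_def by (intro connected_continuous_image continuous_intros) auto
  moreover have "T - W \<noteq> {}"
  proof -
    have "0 \<in> T" unfolding T_def by (rule image_eqI[of _ _ 0]) auto
    moreover have "0 \<notin> W" using WS S(4) V(4) by blast
    ultimately show ?thesis by blast
  qed
  moreover have "T \<inter> W \<noteq> {}"
  proof -
    obtain B where B: "\<And>z. z \<in> - W \<Longrightarrow> norm z \<le> B"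
      using cobounded_outside[OF S(3)] unfolding W_def[symmetric] bounded_iff by blast
    have "norm (\<i> * complex_of_real (\<bar>B\<bar> + 1)) > B" unfolding norm_mult norm_of_real by simp
    then have "\<i> * complex_of_real (\<bar>B\<bar> + 1) \<in> W" using B by force
    then show ?thesis unfolding T_def by blast
  qed
  ultimately have "T \<inter> frontier W \<noteq> {}" by (intro connected_Int_frontier)
  then obtain y where y: "\<i> * of_real y \<in> frontier W" by (auto simp: T_def)
  have "- (\<i> * of_real y) \<in> frontier W"
  proof -
    have sym: "- z \<in> W" if "z \<in> W" for z
      using outside_uminus[OF Ssym] that by (simp add: W_def)
    have "\<i> * of_real y \<in> closure W" "\<i> * of_real y \<notin> W" using y Wo by (auto simp: frontier_def interior_open)
    then have "- (\<i> * of_real y) \<in> closure W" "- (\<i> * of_real y) \<notin> W"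
      using closure_uminus[OF sym] sym[of "- (\<i> * of_real y)"] by auto
    then show ?thesis using Wo by (simp add: frontier_def interior_open)
  qed
  then show ?thesis using that[OF conn dis y] by blast
qed

section \<open>Clopen parts of the Julia set\<close>

context chebyshev_quartic
begin

text \<open>Since the Julia set is closed, two closed pieces in the sphere amount to relative
  clopenness. Without infinity, such a part is a compact set of the plane.\<close>

definition clopen_part :: "sphere set \<Rightarrow> bool" where
  "clopen_part K \<longleftrightarrow> K \<subseteq> julia_set C \<and> closedin riemann_sphere K \<and>
     closedin riemann_sphere (julia_set C - K) \<and> None \<notin> K"

lemma julia_neg: "neg x \<in> julia_set C \<longleftrightarrow> x \<in> julia_set C"
  using fatou_neg[of C, OF C_neg, of x] fatou_neg[of C, OF C_neg, of "neg x"]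
  by (auto simp: julia_set_def)

lemma julia_C: "C x \<in> julia_set C \<longleftrightarrow> x \<in> julia_set C"
  by (simp add: julia_set_def fatou_C_iff)

lemma closedin_neg:
  assumes "closedin riemann_sphere K"
  shows "closedin riemann_sphere {x. neg x \<in> K}"
  using closedin_continuous_map_preimage[OF continuous_map_neg assms] by simp

lemma closed_vimage_Some: "closedin riemann_sphere K \<Longrightarrow> closed (Some -` K)"
  using open_vimage_Some[of "- K"] by (simp add: closedin_riemann_sphere_iff closed_def vimage_Compl)

lemma clopen_part_neg:
  assumes "clopen_part K"
  shows "clopen_part {x. neg x \<in> K}"
proof -
  have eq: "julia_set C - {x. neg x \<in> K} = {x. neg x \<in> julia_set C - K}" using julia_neg by auto
  show ?thesis
    using assms closedin_neg[of K] closedin_neg[of "julia_set C - K"] julia_neg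
    unfolding clopen_part_def eq by auto
qed

lemma clopen_part_Int:
  assumes "clopen_part K" "clopen_part K'"
  shows "clopen_part (K \<inter> K')"
proof -
  have eq: "julia_set C - (K \<inter> K') = (julia_set C - K) \<union> (julia_set C - K')" by blast
  show ?thesis using assms unfolding clopen_part_def eq by (auto intro: closedin_Int closedin_Un)
qed

lemma clopen_part_vimage:
  assumes K: "clopen_part K"
  shows "compact (Some -` K)" "closed (Some -` (julia_set C - K))"
  using K closed_vimage_Some compact_vimage_Some unfolding clopen_part_def by blast+

text \<open>A symmetric continuum in the Fatou set around 0 contains some iy and -iy. Connectedness
  puts both into one basin, the symmetry into the basins of opposite roots, which are
  distinct.\<close>

lemma zero_notin_clopen_part_neg:
  assumes a0: "a < 0" and K: "clopen_part K"
  shows "Some 0 \<notin> K"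
proof
  assume 0: "Some 0 \<in> K"
  \<comment> \<open>Intersecting with the reflected part gives a symmetric clopen part that still
    contains 0.\<close>
  define K1 where "K1 = K \<inter> {x. neg x \<in> K}"
  have K1: "clopen_part K1" unfolding K1_def by (intro clopen_part_Int clopen_part_neg K)
  obtain \<Gamma> y where \<Gamma>: "connected \<Gamma>" "\<Gamma> \<inter> (Some -` K1 \<union> Some -` (julia_set C - K1)) = {}"
    and y: "\<i> * of_real y \<in> \<Gamma>" "- (\<i> * of_real y) \<in> \<Gamma>"
  proof (rule symmetric_separator[OF clopen_part_vimage(1)[OF K1] _ _ clopen_part_vimage(2)[OF K1]])
    show "- z \<in> Some -` K1" if "z \<in> Some -` K1" for z using that by (auto simp: K1_def)
    show "0 \<in> Some -` K1" using 0 by (simp add: K1_def)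
  qed auto
  have F: "Some ` \<Gamma> \<subseteq> fatou_set C"
    using \<Gamma>(2) K1 unfolding clopen_part_def by (auto simp: julia_set_def)
  define b where "b = \<i> * complex_of_real (sqrt (- a))"
  have b: "b \<noteq> 0" using a0 by (simp add: b_def)
  have qb: "quartic (1 + a) a b = 0"
  proof -
    have "quartic (- (1 + a)) a (sqrt (- a)) = ((sqrt (- a))\<^sup>2)\<^sup>2 + (1 + a) * (sqrt (- a))\<^sup>2 + a"
      by (simp add: quartic_def algebra_simps)
    also have "\<dots> = 0" using a0 by (simp add: algebra_simps power2_eq_square)
    finally show ?thesis unfolding b_def quartic_imag by simp
  qed
  then have qb': "quartic (1 + a) a (- b) = 0" by simp
  have "Some (\<i> * of_real y) \<in> basin b \<union> basin (- b)"
    unfolding b_def using F y(1) by (intro fatou_imag_basin[OF a0]) auto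
  then obtain e where e: "e \<noteq> 0" "quartic (1 + a) a e = 0" "Some (\<i> * of_real y) \<in> basin e"
    using b qb qb' by (metis UnE neg_equal_0_iff_equal)
  have "Some (- (\<i> * of_real y)) \<in> basin e"
    by (rule connected_fatou_basin[OF e(2) \<Gamma>(1) F y(1) e(3) y(2)])
  moreover have "Some (- (\<i> * of_real y)) \<in> basin (- e)"
    using basin_neg[OF e(3)] by simp
  ultimately have "e = - e" by (rule basin_unique)
  then show False using e(1) by simp
qed

text \<open>The axis is connected and lies in the Julia set, so a clopen part containing 0 would
  contain all of it, although it is compact in the plane.\<close>

lemma zero_notin_clopen_part_pos:
  assumes a0: "a > 0" and K: "clopen_part K"
  shows "Some 0 \<notin> K"
proof
  assume 0: "Some 0 \<in> K"
  define T where "T = (\<lambda>t. \<i> * complex_of_real t) ` UNIV"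
  have "connected T" unfolding T_def by (intro connected_continuous_image continuous_intros) auto
  moreover have "Some -` K \<inter> Some -` (julia_set C - K) \<inter> T = {}" by blast
  moreover have "T \<subseteq> Some -` K \<union> Some -` (julia_set C - K)"
    using imag_axis_julia[OF a0] by (auto simp: T_def)
  ultimately have "Some -` K \<inter> T = {} \<or> Some -` (julia_set C - K) \<inter> T = {}"
    using clopen_part_vimage[OF K] compact_imp_closed by (intro connected_closedD) auto
  moreover have "0 \<in> T" unfolding T_def by (rule image_eqI[of _ _ 0]) auto
  ultimately have TK: "T \<subseteq> Some -` K" using 0 imag_axis_julia[OF a0] by (auto simp: T_def)
  obtain B where B: "\<And>z. z \<in> Some -` K \<Longrightarrow> norm z \<le> B"
    using compact_imp_bounded[OF clopen_part_vimage(1)[OF K]] unfolding bounded_iff by blast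
  have "norm (\<i> * complex_of_real (\<bar>B\<bar> + 1)) > B" unfolding norm_mult norm_of_real by simp
  moreover have "\<i> * complex_of_real (\<bar>B\<bar> + 1) \<in> Some -` K" using TK unfolding T_def by blast
  ultimately show False using B by force
qed

lemma zero_notin_clopen_part: "clopen_part K \<Longrightarrow> Some 0 \<notin> K"
  using zero_notin_clopen_part_neg zero_notin_clopen_part_pos a(3) by (cases "a < 0") auto

text \<open>The image is the trace on the Julia set of the open set c(U), where U omits the poles
  and the rest of the Julia set: by complete invariance a point of U with image in the Julia set
  already lies in \<open>K\<close>. Compactness of \<open>K\<close> makes the image closed.\<close>

lemma clopen_part_image:
  assumes K: "clopen_part K" and np: "\<And>z. Some z \<in> K \<Longrightarrow> \<not> pole z"
  shows "clopen_part (C ` K)"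
proof -
  have KJ: "K \<subseteq> julia_set C" and cK: "closedin riemann_sphere K"
    and cJ: "closedin riemann_sphere (julia_set C - K)" and N: "None \<notin> K"
    using K by (auto simp: clopen_part_def)
  have im: "C ` K \<subseteq> julia_set C" using KJ julia_C by blast
  have "compactin riemann_sphere (C ` K)"
    using compactin_closed_sphere[OF cK] continuous_C by (rule image_compactin)
  then have cCK: "closedin riemann_sphere (C ` K)"
    by (rule compactin_imp_closedin[OF Hausdorff_space_riemann_sphere])
  have N': "None \<notin> C ` K"
  proof
    assume "None \<in> C ` K"
    then obtain x where x: "x \<in> K" "C x = None" by (metis imageE)
    then obtain z where "x = Some z" using N by (cases x) auto
    then show False using x np by (simp add: C_simps)
  qed
  define U where "U = Some -` (- (julia_set C - K)) \<inter> {z. \<not> pole z}"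
  have "openin riemann_sphere (- (julia_set C - K))" using cJ by (simp add: closedin_riemann_sphere_iff)
  then have "open U" unfolding U_def using open_nonpoles by (intro open_Int open_vimage_Some)
  then have "open (c ` U)" by (rule open_map_c) (simp add: U_def)
  then have oU: "openin riemann_sphere (Some ` c ` U)" by (simp add: openin_Some_image)
  have "C ` K = julia_set C \<inter> Some ` c ` U"
  proof (intro equalityI subsetI)
    fix y assume "y \<in> C ` K"
    then obtain x where x: "x \<in> K" "y = C x" by auto
    then obtain z where z: "x = Some z" using N by (cases x) auto
    have "z \<in> U" using x z np by (simp add: U_def)
    moreover have "y = Some (c z)" using x z np by (simp add: C_simps)
    ultimately show "y \<in> julia_set C \<inter> Some ` c ` U" using im \<open>y \<in> C ` K\<close> by blast
  next
    fix y assume y: "y \<in> julia_set C \<inter> Some ` c ` U"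
    then obtain u where u: "u \<in> U" "y = Some (c u)" by blast
    then have yC: "y = C (Some u)" by (simp add: U_def C_simps)
    then have "Some u \<in> julia_set C" using y julia_C by simp
    then have "Some u \<in> K" using u(1) by (simp add: U_def)
    then show "y \<in> C ` K" using yC by blast
  qed
  then have "julia_set C - C ` K = julia_set C \<inter> (- (Some ` c ` U))" by blast
  moreover have "closedin riemann_sphere (julia_set C \<inter> (- (Some ` c ` U)))"
    using oU closedin_julia_set by (intro closedin_Int) (auto simp: closedin_riemann_sphere_iff)
  ultimately show ?thesis using im cCK N' by (simp add: clopen_part_def)
qed

text \<open>The orbits of points near a clopen part of the Julia set omit three values as soon as no
  clopen part contains a pole, so Montel's theorem leaves no room for a nonempty clopen part.\<close>

lemma clopen_part_empty:
  assumes np: "\<And>K z. clopen_part K \<Longrightarrow> Some z \<in> K \<Longrightarrow> \<not> pole z"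
    and q: "pole q" "q \<noteq> 0" and K: "clopen_part K"
  shows "K = {}"
proof (rule ccontr)
  assume "K \<noteq> {}"
  then obtain \<xi> where \<xi>: "Some \<xi> \<in> K" using K unfolding clopen_part_def by (metis ex_in_conv option.exhaust)
  have Kn: "clopen_part ((C ^^ n) ` K)" for n
  proof (induction n)
    case (Suc n)
    have "(C ^^ Suc n) ` K = C ` (C ^^ n) ` K" by (simp add: image_image)
    then show ?case using clopen_part_image[OF Suc np[OF Suc]] by simp
  qed (use K in simp)
  have "openin riemann_sphere (- (julia_set C - K))"
    using K by (simp add: clopen_part_def closedin_riemann_sphere_iff)
  then have "open (Some -` (- (julia_set C - K)))" by (rule open_vimage_Some)
  moreover have "\<xi> \<in> Some -` (- (julia_set C - K))" using \<xi> by simp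
  ultimately obtain R where R: "R > 0" "cball \<xi> R \<subseteq> Some -` (- (julia_set C - K))"
    using open_contains_cball by (metis (no_types, lifting))
  have orb: "(C ^^ n) (Some w) = Some ((c ^^ n) w) \<and> \<not> pole ((c ^^ n) w)" if w: "w \<in> cball \<xi> R" for w n
  proof (cases "Some w \<in> fatou_set C")
    case True
    then show ?thesis using fatou_orbit by blast
  next
    case False
    then have "Some w \<in> K" using w R(2) by (auto simp: julia_set_def)
    then have inK: "(C ^^ n) (Some w) \<in> (C ^^ n) ` K" by blast
    then have "(C ^^ n) (Some w) \<noteq> None" using Kn[of n] unfolding clopen_part_def by metis
    then have *: "(C ^^ n) (Some w) = Some ((c ^^ n) w)" by (rule funpow_C_Some)
    then have "\<not> pole ((c ^^ n) w)" using np[OF Kn[of n]] inK by simp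
    with * show ?thesis by blast
  qed
  have p0: "pole 0" by (simp add: quartic'_def)
  have "Some \<xi> \<in> fatou_set C"
  proof (rule fatou_if_omits[OF R(1) _ _ _ q(2)])
    show "c ^^ n holomorphic_on cball \<xi> R" for n
    proof (rule holomorphic_onI)
      fix w assume "w \<in> cball \<xi> R"
      then have "((c ^^ n) has_field_derivative (\<Prod>k<n. cheb' (1 + a) a ((c ^^ k) w))) (at w)"
        using orb by (intro has_field_derivative_funpow_c) blast
      then show "(c ^^ n) field_differentiable at w within cball \<xi> R"
        using field_differentiable_at_within field_differentiable_def by blast
    qed
    show "(C ^^ n) (Some w) = Some ((c ^^ n) w)" if "w \<in> cball \<xi> R" for n w using orb[OF that] by blast
    show "(c ^^ n) w \<noteq> 0 \<and> (c ^^ n) w \<noteq> q" if "w \<in> cball \<xi> R" for n w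
      using orb[OF that, of n] p0 q(1) by metis
  qed
  then show False using \<xi> K by (auto simp: clopen_part_def julia_set_def)
qed

lemma pole_cases:
  assumes "pole q" "q \<noteq> 0" "pole z"
  shows "z = 0 \<or> z = q \<or> z = - q"
proof -
  have *: "u = 0 \<or> 2 * u\<^sup>2 = of_real (1 + a)" if "pole u" for u :: complex
  proof -
    have "2 * u * (2 * u\<^sup>2 - of_real (1 + a)) = 0"
      using that by (simp add: quartic'_def algebra_simps power2_eq_square power3_eq_cube)
    then show ?thesis by simp
  qed
  show ?thesis
  proof (cases "z = 0")
    case False
    then have "2 * z\<^sup>2 = 2 * q\<^sup>2" using *[of z] *[of q] assms by simp
    then show ?thesis by (simp add: power2_eq_iff)
  qed simp
qed

text \<open>Components are closed in the compact sphere, so one that misses infinity is compact in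
  the plane.\<close>

lemma julia_component_unbounded:
  assumes "\<not> sphere_bounded (julia_component C x)"
  shows "None \<in> julia_component C x"
proof (rule ccontr)
  define A where "A = julia_component C x"
  assume "None \<notin> julia_component C x"
  then have N: "None \<notin> A" by (simp add: A_def)
  have "closedin (subtopology riemann_sphere (julia_set C)) A"
    unfolding A_def julia_component_def by (rule closedin_connected_component_of)
  then have "closedin riemann_sphere A" by (rule closedin_trans_full[OF _ closedin_julia_set])
  then have "bounded (Some -` A)" using N by (intro compact_imp_bounded compact_vimage_Some)
  moreover have "A = Some ` (Some -` A)"
  proof (intro equalityI subsetI)
    fix y assume "y \<in> A"
    then show "y \<in> Some ` (Some -` A)" using N by (cases y) auto
  qed auto
  ultimately have "sphere_bounded A" unfolding sphere_bounded_def by blast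
  then show False using assms by (simp add: A_def)
qed

lemma julia_connected_iff:
  assumes q: "pole q" "q \<noteq> 0"
  shows "connectedin riemann_sphere (julia_set C) \<longleftrightarrow> \<not> sphere_bounded (julia_component C (Some q))"
proof
  assume conn: "connectedin riemann_sphere (julia_set C)"
  have "connectedin (subtopology riemann_sphere (julia_set C)) (julia_set C)"
    using conn by (simp add: connectedin_subtopology)
  then have "connected_component_of (subtopology riemann_sphere (julia_set C)) (Some q) None"
    unfolding connected_component_of_def using julia_None julia_pole[OF q(1)] by blast
  then have "None \<in> julia_component C (Some q)" by (simp add: julia_component_def)
  then show "\<not> sphere_bounded (julia_component C (Some q))" by (auto simp: sphere_bounded_def)
next
  assume unb: "\<not> sphere_bounded (julia_component C (Some q))"
  have "connected_component_of (subtopology riemann_sphere (julia_set C)) (Some q) None"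
    using julia_component_unbounded[OF unb] by (simp add: julia_component_def)
  then obtain T where "connectedin (subtopology riemann_sphere (julia_set C)) T"
    and T: "Some q \<in> T" "None \<in> T"
    unfolding connected_component_of_def by blast
  then have Tc: "connectedin riemann_sphere T" and TJ: "T \<subseteq> julia_set C"
    by (simp_all add: connectedin_subtopology)
  \<comment> \<open>A clopen part containing q but not infinity would split the connected set
    \<open>T\<close>, which contains both.\<close>
  have nq: "Some q \<notin> K" if K: "clopen_part K" for K
  proof
    assume "Some q \<in> K"
    then have "closedin riemann_sphere K" "closedin riemann_sphere (julia_set C - K)"
      "T \<subseteq> K \<union> (julia_set C - K)" "K \<inter> (julia_set C - K) \<inter> T = {}" "K \<inter> T \<noteq> {}" "(julia_set C - K) \<inter> T \<noteq> {}"
      using K T TJ julia_None unfolding clopen_part_def by auto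
    then show False using Tc unfolding connectedin_closedin by blast
  qed
  have np: "\<not> pole z" if K: "clopen_part K" and z: "Some z \<in> K" for K z
  proof
    assume "pole z"
    then consider "z = 0" | "z = q" | "z = - q" using pole_cases[OF q] by blast
    then show False
    proof cases
      case 1
      then show ?thesis using zero_notin_clopen_part[OF K] z by simp
    next
      case 2
      then show ?thesis using nq[OF K] z by simp
    next
      \<comment> \<open>The reflected clopen part contains q.\<close>
      case 3
      then show ?thesis using nq[OF clopen_part_neg[OF K]] z by simp
    qed
  qed
  have empty: "K = {}" if "clopen_part K" for K
    using np q that by (rule clopen_part_empty)
  show "connectedin riemann_sphere (julia_set C)"
    unfolding connectedin_closedin
  proof (intro conjI notI)
    assume "\<exists>E1 E2. closedin riemann_sphere E1 \<and> closedin riemann_sphere E2 \<and>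
        julia_set C \<subseteq> E1 \<union> E2 \<and> E1 \<inter> E2 \<inter> julia_set C = {} \<and> E1 \<inter> julia_set C \<noteq> {} \<and> E2 \<inter> julia_set C \<noteq> {}"
    then obtain E1 E2 where E: "closedin riemann_sphere E1" "closedin riemann_sphere E2"
        "julia_set C \<subseteq> E1 \<union> E2" "E1 \<inter> E2 \<inter> julia_set C = {}" "E1 \<inter> julia_set C \<noteq> {}" "E2 \<inter> julia_set C \<noteq> {}"
      by blast
    have cl: "closedin riemann_sphere (E1 \<inter> julia_set C)" "closedin riemann_sphere (E2 \<inter> julia_set C)"
      using E closedin_julia_set by (auto intro: closedin_Int)
    have d1: "julia_set C - E1 \<inter> julia_set C = E2 \<inter> julia_set C"
      and d2: "julia_set C - E2 \<inter> julia_set C = E1 \<inter> julia_set C" using E by blast+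
    \<comment> \<open>Infinity lies in at most one of the two pieces; the other is a nonempty clopen
      part.\<close>
    show False
    proof (cases "None \<in> E1")
      case True
      then have "None \<notin> E2 \<inter> julia_set C" using E(4) by blast
      then have "clopen_part (E2 \<inter> julia_set C)" using cl unfolding clopen_part_def d2 by simp
      then show ?thesis using empty E by blast
    next
      case False
      then have "clopen_part (E1 \<inter> julia_set C)" using cl unfolding clopen_part_def d1 by simp
      then show ?thesis using empty E by blast
    qed
  qed simp
qed

end

theorem corollary3p2p1:
  fixes a :: real and q :: complex
  assumes "a \<in> {-1<..<0} \<union> {0<..<1}"
    and "finite_pole (C_map a) q" and "q \<noteq> 0"
  shows "connectedin riemann_sphere (julia_set (C_map a)) \<longleftrightarrow>
         \<not> sphere_bounded (julia_component (C_map a) (Some q))"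
proof -
  interpret chebyshev_quartic a
    using assms(1) by unfold_locales auto
  have "quartic' (1 + a) q = 0"
    using assms(2) by (simp add: finite_pole_def C_simps split: if_splits)
  then show ?thesis using assms(3) by (rule julia_connected_iff)
qed

end
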